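(* Let $f:D\to\mathbb{H}^3$ be a conformal immersion with metric $e^{2u}dz\,d\bar z$, Hopf differential $Q\,dz^2$ and constant mean curvature $H$ with $|H|>1$, where $D\subset\mathbb{C}$ is open, simply connected and contains $0$. Consider the associated family of $f$ with frame $F=F(\theta)$, $\theta\in S^1$, and, for $s>0$, the $s$-deformed connection forms $\Omega^{s\theta}$ defined in the context. Then there exists a value $s=s_0>0$ such that the corresponding $s$-deformation generates a unitary frame: the solution $\tilde F=\tilde F(\theta)$ of $\tilde F^{-1}d\tilde F=\Omega^{s_0\theta}$, $\tilde F(0,\theta)=I$, takes values in $\Lambda\mathrm{SU}(2)$. Moreover, $\tilde F$ is the lift of a harmonic map $\tilde N$ into $S^2$: for each $\theta\in S^1$ the composition of $\tilde F(\cdot,\theta):D\to\mathrm{SU}(2)$ with the natural projection $\mathrm{SU}(2)\to\mathrm{SU}(2)/\mathrm{U}(1)=S^2$ (where $\mathrm{U}(1)$ is the subgroup of diagonal matrices) is a harmonic map.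
   Context: $\mathbb{H}^3$ is hyperbolic 3-space of sectional curvature $-1$, realized as $\{x\in\mathbb{R}^{3,1}:\langle x,x\rangle=-1,\ x^0>0\}$. For a conformal immersion $f$ with coordinate $z$: $\langle f_z,f_z\rangle=0$, $\langle f_z,f_{\bar z}\rangle=\frac12e^{2u}$ with $u$ real; with $N$ the unit normal, $Q=\langle f_{zz},N\rangle$ and $\langle f_{z\bar z},N\rangle=\frac12He^{2u}$. When $H$ is constant the Gauss–Codazzi equations are $u_{z\bar z}-\frac{e^{2u}}{4}(1-H^2)-e^{-2u}Q\overline Q=0$ and $Q_{\bar z}=0$. The generalized spectral parameter is $\lambda=s\theta$ with $s>0$, $\theta=e^{it}\in S^1$. The associated family is obtained by $Q\to\theta^{-2}Q$; the $s$-deformation by $(1+H)\to s(1+H)$, $(1-H)\to s^{-1}(1-H)$ in the connection form. After conjugation by a $z$-independent matrix, the resulting connection form is $$\Omega^{s\theta}=\begin{pmatrix}-\frac12u_z&-\theta^{-1}e^{-u}Q\\ \theta^{-1}\frac s2e^u(1+H)&\frac12u_z\end{pmatrix}dz+\begin{pmatrix}\frac12u_{\bar z}&\theta\frac{s^{-1}}2e^u(1-H)\\ \theta e^{-u}\overline Q&-\frac12u_{\bar z}\end{pmatrix}d\bar z ,$$ and the frame $F(\theta)$ of the associated family is the $\mathrm{SL}(2,\mathbb{C})$-valued solution of $F^{-1}dF=\Omega^{s\theta}$ for $s=1$ with $F(0,\theta)=I$. "Frame generated by the $s$-deformation" means the solution of the same equation for the given $s$. With $\sigma_3=\mathrm{diag}(1,-1)$,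 $\Lambda\mathrm{SL}(2,\mathbb{C})$ is the twisted loop group of maps $g:S^1\to\mathrm{SL}(2,\mathbb{C})$ with $g(-\theta)=\sigma_3g(\theta)\sigma_3^{-1}$, and $\Lambda\mathrm{SU}(2)$ is its subgroup of $\mathrm{SU}(2)$-valued loops. *)

theory Defs
  imports "HOL-Analysis.Analysis"
begin

section \<open>Calculus on open subsets of the complex plane\<close>

definition dx :: "(complex \<Rightarrow> 'b::real_normed_vector) \<Rightarrow> complex \<Rightarrow> 'b"
  where "dx h z = frechet_derivative h (at z) 1"

definition dy :: "(complex \<Rightarrow> 'b::real_normed_vector) \<Rightarrow> complex \<Rightarrow> 'b"
  where "dy h z = frechet_derivative h (at z) \<i>"

text \<open>Differentiability is that of the real variables $(x,y)$; the set is meant to be open.\<close>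

primrec Ck_on :: "nat \<Rightarrow> complex set \<Rightarrow> (complex \<Rightarrow> 'b::real_normed_vector) \<Rightarrow> bool"
  where
    "Ck_on 0 D h \<longleftrightarrow> continuous_on D h"
  | "Ck_on (Suc k) D h \<longleftrightarrow>
       (\<forall>z\<in>D. h differentiable (at z)) \<and> Ck_on k D (dx h) \<and> Ck_on k D (dy h)"

definition smooth_on :: "complex set \<Rightarrow> (complex \<Rightarrow> 'b::real_normed_vector) \<Rightarrow> bool"
  where "smooth_on D h \<longleftrightarrow> (\<forall>k. Ck_on k D h)"

definition d_z :: "(complex \<Rightarrow> complex) \<Rightarrow> complex \<Rightarrow> complex"
  where "d_z h z = (dx h z - \<i> * dy h z) / 2"

definition d_zbar :: "(complex \<Rightarrow> complex) \<Rightarrow> complex \<Rightarrow> complex"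
  where "d_zbar h z = (dx h z + \<i> * dy h z) / 2"

definition vd_z :: "(complex \<Rightarrow> complex^'n) \<Rightarrow> complex \<Rightarrow> complex^'n"
  where "vd_z h z = (\<chi> k. d_z (\<lambda>w. h w $ k) z)"

definition vd_zbar :: "(complex \<Rightarrow> complex^'n) \<Rightarrow> complex \<Rightarrow> complex^'n"
  where "vd_zbar h z = (\<chi> k. d_zbar (\<lambda>w. h w $ k) z)"


section \<open>Surfaces in hyperbolic space\<close>

text \<open>
  The index type \<open>4\<close> has the elements $0, 1, 2, 3$ (and $4 = 0$). The bilinear form is used both
  on real vectors and, without conjugation, on their complexifications.
\<close>

definition mink :: "'a::comm_ring_1^4 \<Rightarrow> 'a^4 \<Rightarrow> 'a"
  where "mink x y = - (x$0 * y$0) + x$1 * y$1 + x$2 * y$2 + x$3 * y$3"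

definition H3 :: "(real^4) set"
  where "H3 = {x. mink x x = -1 \<and> x$0 > 0}"

definition cvec :: "real^'n \<Rightarrow> complex^'n"
  where "cvec x = (\<chi> k. complex_of_real (x $ k))"

definition conformal_immersion :: "complex set \<Rightarrow> (complex \<Rightarrow> real^4) \<Rightarrow> (complex \<Rightarrow> real) \<Rightarrow> bool"
  where "conformal_immersion D f u \<longleftrightarrow>
    smooth_on D f \<and> f ` D \<subseteq> H3 \<and>
    (\<forall>z\<in>D. let fc = (\<lambda>w. cvec (f w)) in
       mink (vd_z fc z) (vd_z fc z) = 0 \<and>
       mink (vd_z fc z) (vd_zbar fc z) = complex_of_real (exp (2 * u z) / 2))"

text \<open>The normal is taken within $T\mathbb{H}^3$, hence also orthogonal to the position vector.
  Either of the two orientations is allowed.\<close>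

definition unit_normal :: "complex set \<Rightarrow> (complex \<Rightarrow> real^4) \<Rightarrow> (complex \<Rightarrow> real^4) \<Rightarrow> bool"
  where "unit_normal D f N \<longleftrightarrow>
    smooth_on D N \<and>
    (\<forall>z\<in>D. mink (N z) (N z) = 1 \<and> mink (N z) (f z) = 0 \<and>
       mink (N z) (dx f z) = 0 \<and> mink (N z) (dy f z) = 0)"

text \<open>The coefficient $Q$ of the Hopf differential $Q\,dz^2$.\<close>

definition hopf_coeff :: "(complex \<Rightarrow> real^4) \<Rightarrow> (complex \<Rightarrow> real^4) \<Rightarrow> complex \<Rightarrow> complex"
  where "hopf_coeff f N z = mink (vd_z (vd_z (\<lambda>w. cvec (f w))) z) (cvec (N z))"

definition has_mean_curvature ::
    "(complex \<Rightarrow> real^4) \<Rightarrow> (complex \<Rightarrow> real^4) \<Rightarrow> (complex \<Rightarrow> real) \<Rightarrow> real \<Rightarrow> complex \<Rightarrow> bool"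
  where "has_mean_curvature f N u H z \<longleftrightarrow>
    mink (vd_zbar (vd_z (\<lambda>w. cvec (f w))) z) (cvec (N z)) =
      complex_of_real (H * exp (2 * u z) / 2)"


section \<open>Deformed connection forms and their frames\<close>

definition mat22 :: "'a \<Rightarrow> 'a \<Rightarrow> 'a \<Rightarrow> 'a \<Rightarrow> 'a::zero^2^2"
  where "mat22 a b c d = vector [vector [a, b], vector [c, d]]"

definition Omega_dz ::
    "(complex \<Rightarrow> real) \<Rightarrow> (complex \<Rightarrow> complex) \<Rightarrow> real \<Rightarrow> real \<Rightarrow> complex \<Rightarrow> complex \<Rightarrow> complex^2^2"
  where "Omega_dz u Q H s \<theta> z =
    (let e = complex_of_real (exp (u z)); uz = d_z (\<lambda>w. complex_of_real (u w)) z in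
       mat22 (- uz / 2) (- (inverse \<theta> * inverse e * Q z))
             (inverse \<theta> * (of_real s / 2) * e * (1 + of_real H)) (uz / 2))"

definition Omega_dzbar ::
    "(complex \<Rightarrow> real) \<Rightarrow> (complex \<Rightarrow> complex) \<Rightarrow> real \<Rightarrow> real \<Rightarrow> complex \<Rightarrow> complex \<Rightarrow> complex^2^2"
  where "Omega_dzbar u Q H s \<theta> z =
    (let e = complex_of_real (exp (u z)); uzb = d_zbar (\<lambda>w. complex_of_real (u w)) z in
       mat22 (uzb / 2) (\<theta> * (inverse (of_real s) / 2) * e * (1 - of_real H))
             (\<theta> * inverse e * cnj (Q z)) (- uzb / 2))"

text \<open>The matrix-valued 1-form at \<open>z\<close>, evaluated on a tangent vector \<open>v\<close>:
  there $dz(v) = v$ and $d\bar z(v) = \bar v$.\<close>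

definition Omega ::
    "(complex \<Rightarrow> real) \<Rightarrow> (complex \<Rightarrow> complex) \<Rightarrow> real \<Rightarrow> real \<Rightarrow> complex \<Rightarrow> complex \<Rightarrow>
     complex \<Rightarrow> complex^2^2"
  where "Omega u Q H s \<theta> z v =
    (\<chi> i j. Omega_dz u Q H s \<theta> z $ i $ j * v + Omega_dzbar u Q H s \<theta> z $ i $ j * cnj v)"

text \<open>
  \<open>F z \<theta>\<close> is the value at \<open>z\<close> of the $\mathrm{SL}(2,\mathbb{C})$-valued solution of
  $F^{-1}dF = \Omega^{s\theta}$ normalized at $0$. The frame of the associated family is the
  case $s = 1$.
\<close>

definition deformed_frame ::
    "complex set \<Rightarrow> (complex \<Rightarrow> real) \<Rightarrow> (complex \<Rightarrow> complex) \<Rightarrow> real \<Rightarrow> real \<Rightarrow>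
     (complex \<Rightarrow> complex \<Rightarrow> complex^2^2) \<Rightarrow> bool"
  where "deformed_frame D u Q H s F \<longleftrightarrow>
    (\<forall>\<theta>\<in>sphere 0 1.
       F 0 \<theta> = mat 1 \<and>
       (\<forall>z\<in>D. det (F z \<theta>) = 1 \<and>
          (\<lambda>w. F w \<theta>) differentiable (at z) \<and>
          (\<forall>v. matrix_inv (F z \<theta>) ** frechet_derivative (\<lambda>w. F w \<theta>) (at z) v
               = Omega u Q H s \<theta> z v)))"


section \<open>Loop groups\<close>

definition adj :: "complex^2^2 \<Rightarrow> complex^2^2"
  where "adj g = (\<chi> i j. cnj (g $ j $ i))"

definition SU2 :: "(complex^2^2) set"
  where "SU2 = {g. det g = 1 \<and> adj g ** g = mat 1}"

definition sigma3 :: "complex^2^2"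
  where "sigma3 = mat22 1 0 0 (-1)"

text \<open>Loops are functions of $\theta$ on the unit circle; values elsewhere are irrelevant.\<close>

definition Loop_SL2 :: "(complex \<Rightarrow> complex^2^2) set"
  where "Loop_SL2 = {g. \<forall>\<theta>\<in>sphere 0 1.
    det (g \<theta>) = 1 \<and> g (- \<theta>) = sigma3 ** g \<theta> ** matrix_inv sigma3}"

definition Loop_SU2 :: "(complex \<Rightarrow> complex^2^2) set"
  where "Loop_SU2 = {g \<in> Loop_SL2. \<forall>\<theta>\<in>sphere 0 1. g \<theta> \<in> SU2}"


section \<open>Harmonic maps into the 2-sphere\<close>

text \<open>
  The round sphere is the unit sphere of $\mathbb{R}^3$. Its Levi-Civita connection is the
  tangential part of the flat derivative, so \<open>tangential (N z) (dx V z)\<close> is the covariant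
  derivative of a vector field $V$ along $N$. The tension field is the trace of the second
  fundamental form of $N$ with respect to the flat metric on the domain; in two dimensions its
  vanishing depends only on the conformal structure of the domain.
\<close>

definition tangential :: "real^3 \<Rightarrow> real^3 \<Rightarrow> real^3"
  where "tangential p v = v - (v \<bullet> p) *\<^sub>R p"

definition tension :: "(complex \<Rightarrow> real^3) \<Rightarrow> complex \<Rightarrow> real^3"
  where "tension N z = tangential (N z) (dx (dx N) z) + tangential (N z) (dy (dy N) z)"

definition harmonic_into_sphere :: "complex set \<Rightarrow> (complex \<Rightarrow> real^3) \<Rightarrow> bool"
  where "harmonic_into_sphere D N \<longleftrightarrow>
    smooth_on D N \<and> N ` D \<subseteq> sphere 0 1 \<and> (\<forall>z\<in>D. tension N z = 0)"

text \<open>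
  The natural projection $\mathrm{SU}(2) \to \mathrm{SU}(2)/\mathrm{U}(1) = S^2$: the left coset
  $g\,\mathrm{U}(1)$ is identified with $g\sigma_3 g^* = x\sigma_1 + y\sigma_2 + z\sigma_3$,
  that is, with $(x,y,z) \in S^2$. The lemmas below show that this descends to a bijection from
  the left cosets onto the sphere. It intertwines left multiplication with rotations, so the
  round metric corresponds to the (up to scale unique) invariant metric on the quotient.
\<close>

definition proj_S2 :: "complex^2^2 \<Rightarrow> real^3"
  where "proj_S2 g =
    (let M = g ** sigma3 ** adj g in vector [Re (M$2$1), Im (M$2$1), Re (M$1$1)])"

definition U1 :: "(complex^2^2) set"
  where "U1 = {g \<in> SU2. g$1$2 = 0 \<and> g$2$1 = 0}"

lemma mat22_nth [simp]:
  "mat22 a b c d $ 1 $ 1 = a" "mat22 a b c d $ 1 $ 2 = b"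
  "mat22 a b c d $ 2 $ 1 = c" "mat22 a b c d $ 2 $ 2 = d"
  by (simp_all add: mat22_def)

lemma SU2_form:
  assumes "g \<in> SU2"
  obtains a b where "g = mat22 a (- cnj b) b (cnj a)" "a * cnj a + b * cnj b = 1"
proof -
  have d: "g$1$1 * g$2$2 - g$1$2 * g$2$1 = 1" and "adj g ** g = mat 1"
    using assms by (auto simp: SU2_def det_2)
  from this(2) have "g ** adj g = mat 1"
    by (rule matrix_left_right_inverse[THEN iffD1])
  then have *: "(g ** adj g)$i$j = (mat 1 :: complex^2^2)$i$j" for i j by simp
  have 1: "g$1$1 * cnj (g$1$1) + g$1$2 * cnj (g$1$2) = 1"
    and 2: "g$2$1 * cnj (g$1$1) + g$2$2 * cnj (g$1$2) = 0"
    using *[of 1 1] *[of 2 1]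
    by (simp_all add: matrix_matrix_mult_def adj_def sum_2 mat_def)
  have 3: "g$2$2 = cnj (g$1$1)" using 1 2 d by algebra
  have 4: "g$2$1 = - cnj (g$1$2)" using 1 2 d by algebra
  show thesis
  proof
    show "g = mat22 (g$1$1) (- cnj (g$2$1)) (g$2$1) (cnj (g$1$1))"
      using 3 4 by (simp add: vec_eq_iff forall_2)
    show "g$1$1 * cnj (g$1$1) + g$2$1 * cnj (g$2$1) = 1"
      using 1 4 by (simp add: mult.commute)
  qed
qed

lemma form_SU2:
  "a * cnj a + b * cnj b = 1 \<Longrightarrow> mat22 a (- cnj b) b (cnj a) \<in> SU2"
  by (simp add: SU2_def det_2 vec_eq_iff forall_2 matrix_matrix_mult_def adj_def sum_2 mat_def
      algebra_simps)

lemma proj_S2_form: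
  "proj_S2 (mat22 a (- cnj b) b (cnj a)) =
     vector [Re (2 * (cnj a * b)), Im (2 * (cnj a * b)), (cmod a)\<^sup>2 - (cmod b)\<^sup>2]"
  unfolding cmod_power2
  by (simp add: proj_S2_def matrix_matrix_mult_def adj_def sigma3_def sum_2
      vec_eq_iff forall_3 power2_eq_square algebra_simps)

lemma cmod_form: "a * cnj a + b * cnj b = 1 \<longleftrightarrow> (cmod a)\<^sup>2 + (cmod b)\<^sup>2 = 1"
  unfolding complex_norm_square[symmetric] of_real_add[symmetric] of_real_eq_1_iff ..

lemma proj_S2_sphere:
  assumes "g \<in> SU2" shows "proj_S2 g \<in> sphere 0 1"
proof -
  obtain a b where g: "g = mat22 a (- cnj b) b (cnj a)" and 1: "a * cnj a + b * cnj b = 1"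
    using SU2_form[OF assms] .
  have "(norm (proj_S2 g))\<^sup>2 =
      (2 * Re (cnj a * b))\<^sup>2 + (2 * Im (cnj a * b))\<^sup>2 + ((cmod a)\<^sup>2 - (cmod b)\<^sup>2)\<^sup>2"
    unfolding g proj_S2_form power2_norm_eq_inner by (simp add: inner_vec_def sum_3 power2_eq_square)
  also have "\<dots> = ((cmod a)\<^sup>2 + (cmod b)\<^sup>2)\<^sup>2"
    unfolding cmod_power2 by (simp add: power2_eq_square algebra_simps)
  also have "\<dots> = 1" using 1 by (simp add: cmod_form)
  finally show ?thesis by (simp add: power2_eq_1_iff) (smt (verit) norm_ge_zero)
qed

lemma proj_S2_fibres:
  assumes "g \<in> SU2" "h \<in> SU2"
  shows "proj_S2 g = proj_S2 h \<longleftrightarrow> (\<exists>k\<in>U1. h = g ** k)"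
proof -
  obtain a b where g: "g = mat22 a (- cnj b) b (cnj a)" and 1: "a * cnj a + b * cnj b = 1"
    using SU2_form[OF assms(1)] .
  obtain c d where h: "h = mat22 c (- cnj d) d (cnj c)" and 2: "c * cnj c + d * cnj d = 1"
    using SU2_form[OF assms(2)] .
  show ?thesis
  proof
    assume "proj_S2 g = proj_S2 h"
    then have ab: "cnj a * b = cnj c * d"
      and "(cmod a)\<^sup>2 - (cmod b)\<^sup>2 = (cmod c)\<^sup>2 - (cmod d)\<^sup>2"
      unfolding g h proj_S2_form by (auto simp: vec_eq_iff forall_3 complex_eq_iff)
    from this(2) have "(cmod a)\<^sup>2 = (cmod c)\<^sup>2" using 1 2 unfolding cmod_form by linarith
    then have ac: "a * cnj a = c * cnj c" by (simp only: complex_norm_square[symmetric])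
    have "cnj a * (a * d) = (a * cnj a) * d" by simp
    also have "\<dots> = c * (cnj c * d)" by (simp only: ac mult.assoc)
    also have "\<dots> = cnj a * (b * c)" by (simp add: ab[symmetric])
    finally have "cnj a * (a * d) = cnj a * (b * c)" .
    moreover have "c = 0" if "a = 0" using ac that by simp
    ultimately have e: "a * d = b * c" by (cases "a = 0") simp_all
    define p where "p = cnj a * c + cnj b * d"
    have c: "c = a * p" and d: "d = b * p"
      using 1 e unfolding p_def by algebra+
    have p: "p * cnj p = 1"
      using 1 2 unfolding c d complex_cnj_mult by algebra
    have "mat22 p 0 0 (cnj p) \<in> U1"
      using form_SU2[of p 0] p by (simp add: U1_def)
    moreover have "h = g ** mat22 p 0 0 (cnj p)"
      unfolding g h c d
      by (simp add: vec_eq_iff forall_2 matrix_matrix_mult_def sum_2)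
    ultimately show "\<exists>k\<in>U1. h = g ** k" by blast
  next
    assume "\<exists>k\<in>U1. h = g ** k"
    then obtain k where k: "k \<in> U1" "h = g ** k" by blast
    then obtain p q where kf: "k = mat22 p (- cnj q) q (cnj p)" and 3: "p * cnj p + q * cnj q = 1"
      using SU2_form unfolding U1_def by blast
    with k(1) have q: "q = 0" by (simp add: U1_def)
    have "c = a * p" "d = b * p"
      using k(2) unfolding g h kf q
      by (simp_all add: vec_eq_iff forall_2 matrix_matrix_mult_def sum_2)
    moreover have p: "p * cnj p = 1" using 3 q by simp
    moreover have "(cmod p)\<^sup>2 = 1"
      using p by (simp only: complex_norm_square[symmetric] of_real_eq_1_iff)
    ultimately have "cnj c * d = cnj a * b" "(cmod c)\<^sup>2 = (cmod a)\<^sup>2" "(cmod d)\<^sup>2 = (cmod b)\<^sup>2"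
      by (simp_all add: norm_mult power_mult_distrib mult.commute)
    then show "proj_S2 g = proj_S2 h"
      unfolding g h proj_S2_form by simp
  qed
qed

lemma proj_S2_image: "proj_S2 ` SU2 = sphere 0 1"
proof
  show "proj_S2 ` SU2 \<subseteq> sphere 0 1" using proj_S2_sphere by blast
  show "sphere 0 1 \<subseteq> proj_S2 ` SU2"
  proof
    fix p :: "real^3" assume "p \<in> sphere 0 1"
    then have p: "(p$1)\<^sup>2 + (p$2)\<^sup>2 + (p$3)\<^sup>2 = 1"
      by (simp add: norm_eq_1 inner_vec_def sum_3 power2_eq_square)
    show "p \<in> proj_S2 ` SU2"
    proof (cases "p$3 = -1")
      case True
      then have "p$1 = 0" "p$2 = 0" using p by (simp_all add: sum_power2_eq_zero_iff)
      then have "p = proj_S2 (mat22 0 (- cnj 1) 1 (cnj 0))"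
        unfolding proj_S2_form using True by (simp add: vec_eq_iff forall_3)
      then show ?thesis using form_SU2[of 0 1] by auto
    next
      case False
      have "(p$3)\<^sup>2 \<le> 1\<^sup>2" using p zero_le_power2[of "p$1"] zero_le_power2[of "p$2"] unfolding one_power2 by linarith
      then have "p$3 > -1" using False abs_le_square_iff[of "p$3" 1] by linarith
      define r where "r = sqrt ((1 + p$3) / 2)"
      have r: "r > 0" "r\<^sup>2 = (1 + p$3) / 2" using \<open>p$3 > -1\<close> by (auto simp: r_def)
      define b where "b = Complex (p$1 / (2 * r)) (p$2 / (2 * r))"
      have "(cmod b)\<^sup>2 = ((p$1)\<^sup>2 + (p$2)\<^sup>2) / (4 * r\<^sup>2)"
        by (simp add: b_def cmod_power2 power_divide power_mult_distrib add_divide_distrib)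
      also have "(p$1)\<^sup>2 + (p$2)\<^sup>2 = (1 - p$3) * (1 + p$3)"
        using p by (simp add: power2_eq_square algebra_simps)
      also have "4 * r\<^sup>2 = 2 * (1 + p$3)" using r(2) by simp
      finally have b: "(cmod b)\<^sup>2 = (1 - p$3) / 2"
        using \<open>p$3 > -1\<close> by (simp only: nonzero_mult_divide_mult_cancel_right)
      have s: "of_real r * cnj (of_real r) + b * cnj b = 1"
        unfolding cmod_form using r b by simp
      have "p = proj_S2 (mat22 (of_real r) (- cnj b) b (cnj (of_real r)))"
        unfolding proj_S2_form using r b by (simp add: vec_eq_iff forall_3 b_def field_simps)
      then show ?thesis using form_SU2[OF s] by blast
    qed
  qed
qed

end

theory Submission
  imports Defs "HOL-Complex_Analysis.Riemann_Mapping"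
begin

text \<open>
  Multiplying $1 + H$ by $s$ and $1 - H$ by $s^{-1}$ keeps the product $1 - H^2$, and the Gauss and
  Codazzi equations contain $H$ only through that product. So every form $\Omega^{s\theta}$ is
  flat. Write $A$ for its $dz$-coefficient. The $d\bar z$-coefficient equals $-A^*$ exactly when
  $s(1 + H) = -s^{-1}(1 - H)$, that is $s^2 = (H - 1)/(H + 1)$, and the right side is positive
  because $|H| > 1$. For this $s_0$ the form takes values in $\mathfrak{su}(2)$, so its frame is
  unitary.

  Put $\upsilon = u_z/2$ and let $q, r$ be the off-diagonal entries of $A$. Everything that is needed
  about the surface is contained in three equations,
  $q_{\bar z} = -2\bar\upsilon q$, $r_{\bar z} = 2\bar\upsilon r$ and
  $\upsilon_{\bar z} + \overline{\upsilon_{\bar z}} = |q|^2 - |r|^2$, which are assumed in the locale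
  \<open>harmonic_data\<close>. They imply that the form is flat (\<open>flat\<close>). The first two say moreover that the
  off-diagonal part of $A$ is $\bar\partial$-parallel with respect to the diagonal part, which is
  the harmonic map equation: for $M = F\sigma_3F^*$ the Laplacian $M_{xx} + M_{yy}$ is a
  real multiple of $M$ (\<open>laplace\<close>), so the tension of the Gauss map vanishes
  (\<open>harmonic_frame\<close>).

  The frame itself is obtained by integrating the flat form. On a convex domain the equation is
  solved along the rays from the base point as an ordinary differential equation
  (\<open>linear_ode_solution\<close>); flatness and a Gronwall estimate show that the endpoint value has the
  prescribed derivative (\<open>flat_convex\<close>). The Riemann mapping theorem transports this to any
  simply connected domain (\<open>flat_simply_connected\<close>). Uniqueness, unitarity and the twisting
  condition come from one observation: if $F$ and $G$ are frames of the same skew-Hermitian form,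
  then $FG^*$ is constant (\<open>frames_agree\<close>).

  The Gauss and Codazzi equations are derived from the immersion (\<open>gauss\<close>, \<open>codazzi\<close>). This uses
  only inner products: at each point $f, N, f_z, f_{\bar z}$ is a basis of $\mathbb{C}^4$ with a
  known Gram matrix, so the product of two vectors is determined by their products with this
  basis (\<open>mink_frame_expansion\<close>).
\<close>

section \<open>Functions of class $C^k$ on a plane domain\<close>

lemma dx_eqI: "(h has_derivative h') (at z) \<Longrightarrow> dx h z = h' 1"
  and dy_eqI: "(h has_derivative h') (at z) \<Longrightarrow> dy h z = h' \<i>"
  unfolding dx_def dy_def by (metis frechet_derivative_at)+

lemma has_derivative_dx_dy:
  assumes "h differentiable (at z)"
  shows "(h has_derivative (\<lambda>v. Re v *\<^sub>R dx h z + Im v *\<^sub>R dy h z)) (at z)"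
proof -
  have *: "(h has_derivative frechet_derivative h (at z)) (at z)"
    using assms frechet_derivative_works by blast
  then interpret bounded_linear "frechet_derivative h (at z)"
    by (rule has_derivative_bounded_linear)
  have "frechet_derivative h (at z) v = Re v *\<^sub>R dx h z + Im v *\<^sub>R dy h z" for v
  proof -
    have "v = Re v *\<^sub>R 1 + Im v *\<^sub>R \<i>" by (simp add: complex_eq_iff)
    then have "frechet_derivative h (at z) v =
        frechet_derivative h (at z) (Re v *\<^sub>R 1 + Im v *\<^sub>R \<i>)" by simp
    then show ?thesis by (simp add: add scale dx_def dy_def)
  qed
  then have "frechet_derivative h (at z) = (\<lambda>v. Re v *\<^sub>R dx h z + Im v *\<^sub>R dy h z)" by (rule ext)
  with * show ?thesis by simp
qed

lemma
  assumes "open D" "z \<in> D" "\<And>w. w \<in> D \<Longrightarrow> h w = k w"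
  shows differentiable_cong_open: "h differentiable (at z) \<longleftrightarrow> k differentiable (at z)"
    and dx_cong: "dx h z = dx k z"
    and dy_cong: "dy h z = dy k z"
proof -
  have "(h has_derivative L) (at z) = (k has_derivative L) (at z)" for L
    using has_derivative_transform_within_open[OF _ assms(1,2)] assms(3) by metis
  then show "h differentiable (at z) \<longleftrightarrow> k differentiable (at z)" "dx h z = dx k z" "dy h z = dy k z"
    by (simp_all add: differentiable_def dx_def dy_def frechet_derivative_def)
qed

text \<open>
  The derivatives are defined by a choice that depends on the germ of the function only; hence
  formulas for \<open>dx\<close> and \<open>dy\<close> that hold on an open set can be substituted inside \<open>Ck_on\<close>, which is
  how all closure properties below are proved.
\<close>

lemma Ck_on_cong:
  assumes "open D" "\<And>w. w \<in> D \<Longrightarrow> h w = k w"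
  shows "Ck_on n D h \<longleftrightarrow> Ck_on n D k"
  using assms(2)
proof (induction n arbitrary: h k)
  case 0
  then show ?case by simp
next
  case (Suc n)
  have "Ck_on n D (dx h) = Ck_on n D (dx k)"
    by (rule Suc.IH, rule dx_cong[OF assms(1) _ Suc.prems])
  moreover have "Ck_on n D (dy h) = Ck_on n D (dy k)"
    by (rule Suc.IH, rule dy_cong[OF assms(1) _ Suc.prems])
  ultimately show ?case using differentiable_cong_open[OF assms(1) _ Suc.prems] by simp
qed

lemma Ck_on_Suc_imp: "Ck_on (Suc n) D h \<Longrightarrow> Ck_on n D h"
proof (induction n arbitrary: h)
  case 0
  then show ?case
    by (auto intro!: continuous_at_imp_continuous_on differentiable_imp_continuous_within)
next
  case (Suc n)
  then show ?case by (metis Ck_on.simps(2))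
qed

lemma Ck_on_bounded_linear:
  assumes "bounded_linear L" "open D" "Ck_on n D h"
  shows "Ck_on n D (\<lambda>z. L (h z))"
  using assms(3)
proof (induction n arbitrary: h)
  case 0
  then show ?case using assms(1) by (simp add: bounded_linear.continuous_on)
next
  case (Suc n)
  have *: "((\<lambda>z. L (h z)) has_derivative (\<lambda>v. L (Re v *\<^sub>R dx h z + Im v *\<^sub>R dy h z))) (at z)"
    if "z \<in> D" for z
    using Suc.prems that by (intro bounded_linear.has_derivative[OF assms(1)] has_derivative_dx_dy) auto
  have "Ck_on n D (dx (\<lambda>z. L (h z)))"
    using Ck_on_cong[OF assms(2), THEN iffD2, OF _ Suc.IH[of "dx h"]] dx_eqI[OF *] Suc.prems by simp
  moreover have "Ck_on n D (dy (\<lambda>z. L (h z)))"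
    using Ck_on_cong[OF assms(2), THEN iffD2, OF _ Suc.IH[of "dy h"]] dy_eqI[OF *] Suc.prems by simp
  ultimately show ?case using * by (auto simp: differentiable_def)
qed

lemma Ck_on_const: "open D \<Longrightarrow> Ck_on n D (\<lambda>z. c)"
proof (induction n arbitrary: c)
  case (Suc n)
  have "dx (\<lambda>z. c) = (\<lambda>z. 0)" "dy (\<lambda>z. c) = (\<lambda>z. 0)"
    by (auto simp: dx_eqI[OF has_derivative_const] dy_eqI[OF has_derivative_const])
  then show ?case using Suc by simp
qed simp

lemma Ck_on_add:
  assumes "open D" "Ck_on n D h" "Ck_on n D k"
  shows "Ck_on n D (\<lambda>z. h z + k z)"
  using assms(2,3)
proof (induction n arbitrary: h k)
  case 0
  then show ?case by (simp add: continuous_on_add)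
next
  case (Suc n)
  have *: "((\<lambda>z. h z + k z) has_derivative (\<lambda>v. (Re v *\<^sub>R dx h z + Im v *\<^sub>R dy h z) +
      (Re v *\<^sub>R dx k z + Im v *\<^sub>R dy k z))) (at z)"
    if "z \<in> D" for z
    using Suc.prems that by (intro has_derivative_add has_derivative_dx_dy) auto
  have "Ck_on n D (dx (\<lambda>z. h z + k z))"
    using Ck_on_cong[OF assms(1), THEN iffD2, OF _ Suc.IH[of "dx h" "dx k"]] dx_eqI[OF *] Suc.prems by simp
  moreover have "Ck_on n D (dy (\<lambda>z. h z + k z))"
    using Ck_on_cong[OF assms(1), THEN iffD2, OF _ Suc.IH[of "dy h" "dy k"]] dy_eqI[OF *] Suc.prems by simp
  ultimately show ?case using * by (auto simp: differentiable_def)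
qed

lemma
  assumes "bounded_bilinear pr" "h differentiable (at z)" "k differentiable (at z)"
  shows differentiable_bilinear: "(\<lambda>w. pr (h w) (k w)) differentiable (at z)"
    and dx_bilinear: "dx (\<lambda>w. pr (h w) (k w)) z = pr (h z) (dx k z) + pr (dx h z) (k z)"
    and dy_bilinear: "dy (\<lambda>w. pr (h w) (k w)) z = pr (h z) (dy k z) + pr (dy h z) (k z)"
proof -
  note * = bounded_bilinear.FDERIV[OF assms(1) has_derivative_dx_dy[OF assms(2)]
    has_derivative_dx_dy[OF assms(3)]]
  show "(\<lambda>w. pr (h w) (k w)) differentiable (at z)" using * by (auto simp: differentiable_def)
  show "dx (\<lambda>w. pr (h w) (k w)) z = pr (h z) (dx k z) + pr (dx h z) (k z)"
    using dx_eqI[OF *] by simp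
  show "dy (\<lambda>w. pr (h w) (k w)) z = pr (h z) (dy k z) + pr (dy h z) (k z)"
    using dy_eqI[OF *] by simp
qed

lemma Ck_on_bilinear:
  assumes "bounded_bilinear pr" "open D" "Ck_on n D h" "Ck_on n D k"
  shows "Ck_on n D (\<lambda>z. pr (h z) (k z))"
  using assms(3,4)
proof (induction n arbitrary: h k)
  case 0
  then show ?case using bounded_bilinear.continuous_on[OF assms(1)] by simp
next
  case (Suc n)
  have h: "Ck_on n D h" and k: "Ck_on n D k" using Suc.prems Ck_on_Suc_imp by blast+
  have d: "h differentiable (at z)" "k differentiable (at z)" if "z \<in> D" for z
    using Suc.prems that by auto
  have "Ck_on n D (dx (\<lambda>z. pr (h z) (k z)))"
    by (rule Ck_on_cong[OF assms(2), THEN iffD2,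
        OF dx_bilinear[OF assms(1) d] Ck_on_add[OF assms(2) Suc.IH Suc.IH]])
      (use h k Suc.prems in auto)
  moreover have "Ck_on n D (dy (\<lambda>z. pr (h z) (k z)))"
    by (rule Ck_on_cong[OF assms(2), THEN iffD2,
        OF dy_bilinear[OF assms(1) d] Ck_on_add[OF assms(2) Suc.IH Suc.IH]])
      (use h k Suc.prems in auto)
  ultimately show ?case using differentiable_bilinear[OF assms(1) d] by simp
qed

lemma
  fixes h :: "complex \<Rightarrow> real"
  assumes "h differentiable (at z)" "(\<phi> has_field_derivative \<phi>') (at (h z))"
  shows differentiable_chain_real: "(\<lambda>w. \<phi> (h w)) differentiable (at z)"
    and dx_chain_real: "dx (\<lambda>w. \<phi> (h w)) z = \<phi>' * dx h z"
    and dy_chain_real: "dy (\<lambda>w. \<phi> (h w)) z = \<phi>' * dy h z"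
proof -
  have "((\<lambda>w. \<phi> (h w)) has_derivative (\<lambda>v. \<phi>' * (Re v *\<^sub>R dx h z + Im v *\<^sub>R dy h z))) (at z)"
    using has_derivative_compose[OF has_derivative_dx_dy[OF assms(1)]
        assms(2)[unfolded has_field_derivative_def]] by simp
  note * = this
  show "(\<lambda>w. \<phi> (h w)) differentiable (at z)" using * by (auto simp: differentiable_def)
  show "dx (\<lambda>w. \<phi> (h w)) z = \<phi>' * dx h z" using dx_eqI[OF *] by simp
  show "dy (\<lambda>w. \<phi> (h w)) z = \<phi>' * dy h z" using dy_eqI[OF *] by simp
qed

lemma Ck_on_exp:
  fixes h :: "complex \<Rightarrow> real"
  assumes "open D" "Ck_on n D h"
  shows "Ck_on n D (\<lambda>z. exp (h z))"
  using assms(2)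
proof (induction n)
  case 0
  then show ?case by (simp add: continuous_on_exp)
next
  case (Suc n)
  have IH: "Ck_on n D (\<lambda>z. exp (h z))" using Suc Ck_on_Suc_imp by blast
  have d: "h differentiable (at z)" if "z \<in> D" for z using Suc.prems that by auto
  have "Ck_on n D (dx (\<lambda>z. exp (h z)))" "Ck_on n D (dy (\<lambda>z. exp (h z)))"
    by (rule Ck_on_cong[OF assms(1), THEN iffD2, OF dx_chain_real[OF d DERIV_exp]
          Ck_on_bilinear[OF bounded_bilinear_mult assms(1) IH]]
        Ck_on_cong[OF assms(1), THEN iffD2, OF dy_chain_real[OF d DERIV_exp]
          Ck_on_bilinear[OF bounded_bilinear_mult assms(1) IH]]; use Suc.prems in simp)+
  then show ?case using differentiable_chain_real[OF d DERIV_exp] by simp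
qed

lemma Ck_on_inverse:
  fixes h :: "complex \<Rightarrow> real"
  assumes "open D" "\<And>z. z \<in> D \<Longrightarrow> h z \<noteq> 0" "Ck_on n D h"
  shows "Ck_on n D (\<lambda>z. inverse (h z))"
  using assms(3)
proof (induction n)
  case 0
  then show ?case using assms(2) by (simp add: continuous_on_inverse)
next
  case (Suc n)
  have IH: "Ck_on n D (\<lambda>z. inverse (h z))" using Suc Ck_on_Suc_imp by blast
  have d: "h differentiable (at z)" if "z \<in> D" for z using Suc.prems that by auto
  note * = DERIV_inverse[OF assms(2), unfolded numeral_2_eq_2]
  have c: "Ck_on n D (\<lambda>z. - (inverse (h z) ^ Suc (Suc 0)))"
    using Ck_on_bounded_linear[OF bounded_linear_minus[OF bounded_linear_ident] assms(1)
      Ck_on_bilinear[OF bounded_bilinear_mult assms(1) IH IH]]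
    by simp
  have "Ck_on n D (dx (\<lambda>z. inverse (h z)))" "Ck_on n D (dy (\<lambda>z. inverse (h z)))"
    by (rule Ck_on_cong[OF assms(1), THEN iffD2, OF dx_chain_real[OF d *]
          Ck_on_bilinear[OF bounded_bilinear_mult assms(1) c]]
        Ck_on_cong[OF assms(1), THEN iffD2, OF dy_chain_real[OF d *]
          Ck_on_bilinear[OF bounded_bilinear_mult assms(1) c]]; use Suc.prems in simp)+
  then show ?case using differentiable_chain_real[OF d *] by simp
qed

lemma Ck_on_ln:
  fixes h :: "complex \<Rightarrow> real"
  assumes "open D" "\<And>z. z \<in> D \<Longrightarrow> h z > 0" "Ck_on n D h"
  shows "Ck_on n D (\<lambda>z. ln (h z))"
proof (cases n)
  case 0
  then show ?thesis using assms(2,3) by (auto intro!: continuous_on_ln) (metis less_irrefl)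
next
  case (Suc m)
  have d: "h differentiable (at z)" if "z \<in> D" for z using assms(3) Suc that by auto
  have c: "Ck_on m D (\<lambda>z. inverse (h z))"
    using Ck_on_inverse[OF assms(1)] assms Suc Ck_on_Suc_imp by (metis less_irrefl)
  note * = DERIV_ln[OF assms(2)]
  have "Ck_on m D (dx (\<lambda>z. ln (h z)))" "Ck_on m D (dy (\<lambda>z. ln (h z)))"
    by (rule Ck_on_cong[OF assms(1), THEN iffD2, OF dx_chain_real[OF d *]
          Ck_on_bilinear[OF bounded_bilinear_mult assms(1) c]]
        Ck_on_cong[OF assms(1), THEN iffD2, OF dy_chain_real[OF d *]
          Ck_on_bilinear[OF bounded_bilinear_mult assms(1) c]]; use assms(3) Suc in simp)+
  then show ?thesis using differentiable_chain_real[OF d *] Suc by simp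
qed

lemma
  assumes "h differentiable (at (g z))" "(g has_field_derivative g') (at z)"
  shows differentiable_holomorphic_chain: "(\<lambda>w. h (g w)) differentiable (at z)"
    and dx_holomorphic_chain:
      "dx (\<lambda>w. h (g w)) z = Re g' *\<^sub>R dx h (g z) + Im g' *\<^sub>R dy h (g z)"
    and dy_holomorphic_chain:
      "dy (\<lambda>w. h (g w)) z = Re g' *\<^sub>R dy h (g z) - Im g' *\<^sub>R dx h (g z)"
proof -
  note * = has_derivative_compose[OF assms(2)[unfolded has_field_derivative_def]
      has_derivative_dx_dy[OF assms(1)]]
  show "(\<lambda>w. h (g w)) differentiable (at z)" using * by (auto simp: differentiable_def)
  show "dx (\<lambda>w. h (g w)) z = Re g' *\<^sub>R dx h (g z) + Im g' *\<^sub>R dy h (g z)"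
    using dx_eqI[OF *] by simp
  show "dy (\<lambda>w. h (g w)) z = Re g' *\<^sub>R dy h (g z) - Im g' *\<^sub>R dx h (g z)"
    using dy_eqI[OF *] by simp
qed

lemma
  fixes g :: "complex \<Rightarrow> complex"
  assumes "(g has_field_derivative g') (at z)"
  shows dx_holomorphic: "dx g z = g'" and dy_holomorphic: "dy g z = \<i> * g'"
  using dx_eqI[OF assms[unfolded has_field_derivative_def]]
    dy_eqI[OF assms[unfolded has_field_derivative_def]] by (simp_all add: mult.commute)

lemma Ck_on_holomorphic:
  assumes "open D" "g holomorphic_on D"
  shows "Ck_on n D g"
  using assms(2)
proof (induction n arbitrary: g)
  case 0
  then show ?case by (simp add: holomorphic_on_imp_continuous_on)
next
  case (Suc n)
  have *: "(g has_field_derivative deriv g z) (at z)" if "z \<in> D" for z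
    using Suc.prems assms(1) that holomorphic_derivI by blast
  have d: "Ck_on n D (deriv g)" using Suc assms(1) holomorphic_deriv by blast
  have "Ck_on n D (dx g)"
    by (rule Ck_on_cong[OF assms(1), THEN iffD2, OF dx_holomorphic[OF *] d])
  moreover have "Ck_on n D (dy g)"
    by (rule Ck_on_cong[OF assms(1), THEN iffD2, OF dy_holomorphic[OF *]
          Ck_on_bounded_linear[OF bounded_linear_mult_right assms(1) d]])
  ultimately show ?case using *
    by (auto simp: has_field_derivative_def differentiable_def)
qed

lemma Ck_on_holomorphic_chain:
  assumes "open D" "g holomorphic_on D" "g ` D \<subseteq> S" "Ck_on n S h"
  shows "Ck_on n D (\<lambda>z. h (g z))"
  using assms(4)
proof (induction n arbitrary: h)
  case 0
  then show ?case
    using continuous_on_compose2 holomorphic_on_imp_continuous_on assms(2,3) by fastforce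
next
  case (Suc n)
  have *: "(g has_field_derivative deriv g z) (at z)" if "z \<in> D" for z
    using assms(1,2) that holomorphic_derivI by blast
  have d: "h differentiable (at (g z))" if "z \<in> D" for z
    using Suc.prems assms(3) that by auto
  have g: "Ck_on n D (\<lambda>z. Re (deriv g z))" "Ck_on n D (\<lambda>z. Im (deriv g z))"
    using Ck_on_bounded_linear[OF bounded_linear_Re assms(1)]
      Ck_on_bounded_linear[OF bounded_linear_Im assms(1)]
      Ck_on_holomorphic[OF assms(1) holomorphic_deriv[OF assms(2,1)]] by blast+
  have h: "Ck_on n D (\<lambda>z. dx h (g z))" "Ck_on n D (\<lambda>z. dy h (g z))"
    using Suc by auto
  note sc = Ck_on_bilinear[OF bounded_bilinear_scaleR assms(1)]
  have "Ck_on n D (dx (\<lambda>z. h (g z)))"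
    by (rule Ck_on_cong[OF assms(1), THEN iffD2, OF dx_holomorphic_chain[OF d *]
          Ck_on_add[OF assms(1) sc[OF g(1) h(1)] sc[OF g(2) h(2)]]])
  moreover have "Ck_on n D (dy (\<lambda>z. h (g z)))"
    by (rule Ck_on_cong[OF assms(1), THEN iffD2, OF dy_holomorphic_chain[OF d *,
          unfolded diff_conv_add_uminus]
          Ck_on_add[OF assms(1) sc[OF g(1) h(2)]
          Ck_on_bounded_linear[OF bounded_linear_minus[OF bounded_linear_ident] assms(1)
            sc[OF g(2) h(1)]]]])
  ultimately show ?case using differentiable_holomorphic_chain[OF d *] by simp
qed

section \<open>Symmetry of second derivatives\<close>

text \<open>
  The second difference of $h$ over a square of side $r$ can be evaluated by the mean value theorem
  in either order of the variables. The two evaluations give $r^2 h_{xy}$ and $r^2 h_{yx}$ at points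
  of the square.
\<close>

lemma mixed_difference_quotient:
  fixes h :: "complex \<Rightarrow> real"
  assumes "0 < r" and R: "\<And>s t. 0 \<le> s \<Longrightarrow> s \<le> r \<Longrightarrow> 0 \<le> t \<Longrightarrow> t \<le> r \<Longrightarrow> z + Complex s t \<in> D"
    and "\<forall>w\<in>D. h differentiable (at w)"
  defines "\<Delta> \<equiv> h (z + Complex r r) - h (z + Complex r 0) - h (z + Complex 0 r) + h z"
  shows "\<forall>w\<in>D. dx h differentiable (at w) \<Longrightarrow>
      \<exists>s t. 0 \<le> s \<and> s \<le> r \<and> 0 \<le> t \<and> t \<le> r \<and> \<Delta> = r\<^sup>2 * dy (dx h) (z + Complex s t)"
    and "\<forall>w\<in>D. dy h differentiable (at w) \<Longrightarrow>
      \<exists>s t. 0 \<le> s \<and> s \<le> r \<and> 0 \<le> t \<and> t \<le> r \<and> \<Delta> = r\<^sup>2 * dx (dy h) (z + Complex s t)"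
proof -
  have hor: "((\<lambda>s. k (z + Complex s t)) has_real_derivative dx k (z + Complex s t)) (at s)"
    if "k differentiable (at (z + Complex s t))" for k :: "complex \<Rightarrow> real" and s t
  proof -
    have "((\<lambda>s. z + Complex s t) has_derivative complex_of_real) (at s)"
      unfolding Complex_eq by (auto intro!: derivative_eq_intros)
    from has_derivative_compose[OF this has_derivative_dx_dy[OF that]]
    show ?thesis by (simp add: has_field_derivative_def mult_commute_abs)
  qed
  have ver: "((\<lambda>t. k (z + Complex s t)) has_real_derivative dy k (z + Complex s t)) (at t)"
    if "k differentiable (at (z + Complex s t))" for k :: "complex \<Rightarrow> real" and s t
  proof -
    have "((\<lambda>t. z + Complex s t) has_derivative (\<lambda>t. \<i> * complex_of_real t)) (at t)"
      unfolding Complex_eq by (auto intro!: derivative_eq_intros)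
    from has_derivative_compose[OF this has_derivative_dx_dy[OF that]]
    show ?thesis by (simp add: has_field_derivative_def mult_commute_abs)
  qed
  have z0: "z + Complex 0 0 = z" by (simp add: complex_eq_iff)
  {
    assume d: "\<forall>w\<in>D. dx h differentiable (at w)"
    have "\<exists>s. 0 < s \<and> s < r \<and> (h (z + Complex r r) - h (z + Complex r 0)) -
        (h (z + Complex 0 r) - h (z + Complex 0 0)) =
        (r - 0) * (dx h (z + Complex s r) - dx h (z + Complex s 0))"
      by (rule MVT2[OF \<open>0 < r\<close>]) (use assms(1-3) in \<open>auto intro!: DERIV_diff hor\<close>)
    then obtain s where s: "0 < s" "s < r"
      "\<Delta> = r * (dx h (z + Complex s r) - dx h (z + Complex s 0))"
      unfolding \<Delta>_def z0 by auto
    have "\<exists>t. 0 < t \<and> t < r \<and> dx h (z + Complex s r) - dx h (z + Complex s 0) =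
        (r - 0) * dy (dx h) (z + Complex s t)"
      by (rule MVT2[OF \<open>0 < r\<close>]) (use assms(1-3) d s in \<open>auto intro!: ver\<close>)
    then obtain t where "0 < t" "t < r"
      "dx h (z + Complex s r) - dx h (z + Complex s 0) = r * dy (dx h) (z + Complex s t)" by auto
    then show "\<exists>s t. 0 \<le> s \<and> s \<le> r \<and> 0 \<le> t \<and> t \<le> r \<and> \<Delta> = r\<^sup>2 * dy (dx h) (z + Complex s t)"
      using s by (intro exI[of _ s] exI[of _ t]) (auto simp: power2_eq_square)
  }
  {
    assume d: "\<forall>w\<in>D. dy h differentiable (at w)"
    have "\<exists>t. 0 < t \<and> t < r \<and> (h (z + Complex r r) - h (z + Complex 0 r)) -
        (h (z + Complex r 0) - h (z + Complex 0 0)) =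
        (r - 0) * (dy h (z + Complex r t) - dy h (z + Complex 0 t))"
      by (rule MVT2[OF \<open>0 < r\<close>]) (use assms(1-3) in \<open>auto intro!: DERIV_diff ver\<close>)
    then obtain t where t: "0 < t" "t < r"
      "\<Delta> = r * (dy h (z + Complex r t) - dy h (z + Complex 0 t))"
      unfolding \<Delta>_def z0 by auto
    have "\<exists>s. 0 < s \<and> s < r \<and> dy h (z + Complex r t) - dy h (z + Complex 0 t) =
        (r - 0) * dx (dy h) (z + Complex s t)"
      by (rule MVT2[OF \<open>0 < r\<close>]) (use assms(1-3) d t in \<open>auto intro!: hor\<close>)
    then obtain s where "0 < s" "s < r"
      "dy h (z + Complex r t) - dy h (z + Complex 0 t) = r * dx (dy h) (z + Complex s t)" by auto
    then show "\<exists>s t. 0 \<le> s \<and> s \<le> r \<and> 0 \<le> t \<and> t \<le> r \<and> \<Delta> = r\<^sup>2 * dx (dy h) (z + Complex s t)"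
      using t by (intro exI[of _ s] exI[of _ t]) (auto simp: power2_eq_square)
  }
qed

text \<open>
  As the square shrinks to a point, continuity forces the two values from
  \<open>mixed_difference_quotient\<close> together.
\<close>

lemma mixed_partials_commute_real:
  fixes h :: "complex \<Rightarrow> real"
  assumes "open D" "Ck_on 2 D h" "z \<in> D"
  shows "dx (dy h) z = dy (dx h) z"
proof (rule ccontr)
  assume ne: "dx (dy h) z \<noteq> dy (dx h) z"
  define e where "e = \<bar>dx (dy h) z - dy (dx h) z\<bar> / 2"
  have "e > 0" using ne by (simp add: e_def)
  have C: "\<forall>w\<in>D. h differentiable (at w)" "\<forall>w\<in>D. dx h differentiable (at w)"
    "\<forall>w\<in>D. dy h differentiable (at w)" "continuous_on D (dx (dy h))" "continuous_on D (dy (dx h))"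
    using assms(2) by (auto simp: numeral_2_eq_2)
  have "isCont (dx (dy h)) z" "isCont (dy (dx h)) z"
    using C(4,5) assms(1,3) continuous_on_eq_continuous_at by blast+
  then have "\<exists>d>0. \<forall>w. dist w z < d \<longrightarrow> dist (dx (dy h) w) (dx (dy h) z) < e"
    "\<exists>d>0. \<forall>w. dist w z < d \<longrightarrow> dist (dy (dx h) w) (dy (dx h) z) < e"
    unfolding continuous_at_eps_delta using \<open>e > 0\<close> by (simp_all add: dist_norm)
  then obtain d1 d2 where d: "d1 > 0" "\<And>w. dist w z < d1 \<Longrightarrow> dist (dx (dy h) w) (dx (dy h) z) < e"
    "d2 > 0" "\<And>w. dist w z < d2 \<Longrightarrow> dist (dy (dx h) w) (dy (dx h) z) < e"
    by blast
  obtain d3 where d3: "d3 > 0" "ball z d3 \<subseteq> D"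
    using assms(1,3) open_contains_ball by blast
  define r where "r = min d1 (min d2 d3) / 3"
  have r: "r > 0" "3 * r \<le> d1" "3 * r \<le> d2" "3 * r \<le> d3"
    using d(1,3) d3(1) by (auto simp: r_def)
  have near: "dist (z + Complex s t) z < 3 * r" if "0 \<le> s" "s \<le> r" "0 \<le> t" "t \<le> r" for s t
    using cmod_le[of "Complex s t"] that r(1) by (simp add: dist_norm)
  then have R: "z + Complex s t \<in> D" if "0 \<le> s" "s \<le> r" "0 \<le> t" "t \<le> r" for s t
    using d3(2) r(4) that by (force simp: dist_commute)
  obtain s t where st: "0 \<le> s" "s \<le> r" "0 \<le> t" "t \<le> r"
    and 1: "h (z + Complex r r) - h (z + Complex r 0) - h (z + Complex 0 r) + h z =
      r\<^sup>2 * dy (dx h) (z + Complex s t)"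
    using mixed_difference_quotient(1)[OF r(1) R C(1,2)] by blast
  obtain s' t' where st': "0 \<le> s'" "s' \<le> r" "0 \<le> t'" "t' \<le> r"
    and 2: "h (z + Complex r r) - h (z + Complex r 0) - h (z + Complex 0 r) + h z =
      r\<^sup>2 * dx (dy h) (z + Complex s' t')"
    using mixed_difference_quotient(2)[OF r(1) R C(1,3)] by blast
  have eq: "dy (dx h) (z + Complex s t) = dx (dy h) (z + Complex s' t')"
    using 1 2 r(1) by simp
  from st st' have "dist (z + Complex s' t') z < d1" "dist (z + Complex s t) z < d2"
    using near r by (meson less_le_trans)+
  from d(2)[OF this(1)] d(4)[OF this(2)]
  have "\<bar>dx (dy h) z - dy (dx h) z\<bar> < e + e"
    unfolding eq dist_real_def by linarith
  then show False by (simp add: e_def)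
qed

lemma mixed_partials_commute:
  fixes h :: "complex \<Rightarrow> 'b::real_inner"
  assumes "open D" "Ck_on 2 D h" "z \<in> D"
  shows "dx (dy h) z = dy (dx h) z"
proof -
  have C: "\<And>w. w \<in> D \<Longrightarrow> h differentiable (at w)" "\<And>w. w \<in> D \<Longrightarrow> dx h differentiable (at w)"
    "\<And>w. w \<in> D \<Longrightarrow> dy h differentiable (at w)"
    using assms(2) by (auto simp: numeral_2_eq_2)
  have "dx (dy h) z \<bullet> a = dy (dx h) z \<bullet> a" for a
  proof -
    have d: "((\<lambda>w. k w \<bullet> a) has_derivative (\<lambda>v. (Re v *\<^sub>R dx k w + Im v *\<^sub>R dy k w) \<bullet> a)) (at w)"
      if "k differentiable (at w)" for k :: "complex \<Rightarrow> 'b" and w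
      using has_derivative_inner_left[OF has_derivative_dx_dy[OF that]] .
    have "dx (dy h) z \<bullet> a = dx (\<lambda>w. dy h w \<bullet> a) z"
      using dx_eqI[OF d] C assms(3) by simp
    also have "\<dots> = dx (dy (\<lambda>w. h w \<bullet> a)) z"
      by (rule dx_cong[OF assms(1,3)]) (use dy_eqI[OF d] C in simp)
    also have "\<dots> = dy (dx (\<lambda>w. h w \<bullet> a)) z"
      by (intro mixed_partials_commute_real[OF assms(1) _ assms(3)]
          Ck_on_bounded_linear[OF bounded_linear_inner_left] assms)
    also have "\<dots> = dy (\<lambda>w. dx h w \<bullet> a) z"
      by (rule dy_cong[OF assms(1,3)]) (use dx_eqI[OF d] C in simp)
    also have "\<dots> = dy (dx h) z \<bullet> a"
      using dy_eqI[OF d] C assms(3) by simp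
    finally show ?thesis .
  qed
  then show ?thesis using vector_eq_rdot by blast
qed

section \<open>Linear differential equations on the unit interval\<close>

text \<open>
  The function $e^{-(2K+1)t}|y|^2 - \eta^2 t$ is nonincreasing, because
  $2\langle y, y'\rangle \le 2K|y|^2 + 2\eta|y| \le (2K+1)|y|^2 + \eta^2$. Working with $|y|^2$
  avoids differentiating the norm at zeros of $y$.
\<close>

lemma gronwall:
  fixes y :: "real \<Rightarrow> 'a::real_inner"
  assumes y: "\<And>t. t \<in> {0..1} \<Longrightarrow> (y has_vector_derivative y' t) (at t within {0..1})"
    and bound: "\<And>t. t \<in> {0..1} \<Longrightarrow> norm (y' t) \<le> K * norm (y t) + \<eta>"
    and "y 0 = 0" "0 \<le> K" "0 \<le> \<eta>"
  shows "norm (y 1) \<le> \<eta> * exp (2 * K + 1)"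
proof -
  define C where "C = 2 * K + 1"
  define E where "E t = exp (- (C * t)) * (y t \<bullet> y t) - \<eta>\<^sup>2 * t" for t
  define E' where "E' t = exp (- (C * t)) * (2 * (y t \<bullet> y' t) - C * (y t \<bullet> y t)) - \<eta>\<^sup>2" for t
  have "(E has_derivative (\<lambda>h. h * E' t)) (at t within {0..1})" if "0 \<le> t" "t \<le> 1" for t
  proof -
    have "(y has_derivative (\<lambda>h. h *\<^sub>R y' t)) (at t within {0..1})"
      using y that by (simp add: has_vector_derivative_def)
    then show ?thesis
      unfolding E_def E'_def
      by (auto intro!: derivative_eq_intros simp: algebra_simps inner_commute)
  qed
  from mvt_very_simple[OF zero_le_one this]
  obtain t where t: "t \<in> {0..1}" and E: "E 1 - E 0 = E' t" by auto
  have n: "y t \<bullet> y t = (norm (y t))\<^sup>2" by (simp add: power2_norm_eq_inner)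
  have "y t \<bullet> y' t \<le> norm (y t) * norm (y' t)" by (rule norm_cauchy_schwarz)
  also have "\<dots> \<le> norm (y t) * (K * norm (y t) + \<eta>)"
    by (intro mult_left_mono bound t) simp
  finally have 1: "2 * (y t \<bullet> y' t) \<le> 2 * K * (norm (y t))\<^sup>2 + 2 * (norm (y t) * \<eta>)"
    by (simp add: power2_eq_square algebra_simps)
  have 2: "2 * (norm (y t) * \<eta>) \<le> (norm (y t))\<^sup>2 + \<eta>\<^sup>2"
    using sum_squares_bound[of "norm (y t)" \<eta>] by simp
  have "2 * (y t \<bullet> y' t) - C * (y t \<bullet> y t) \<le> \<eta>\<^sup>2"
    using 1 2 by (simp add: n C_def algebra_simps)
  then have "exp (- (C * t)) * (2 * (y t \<bullet> y' t) - C * (y t \<bullet> y t)) \<le> exp (- (C * t)) * \<eta>\<^sup>2"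
    by (intro mult_left_mono) auto
  also have "\<dots> \<le> 1 * \<eta>\<^sup>2"
    using t assms(4) by (intro mult_right_mono) (auto simp: C_def)
  finally have "E 1 \<le> 0" using E assms(3) by (simp add: E'_def E_def)
  then have "exp (- C) * (norm (y 1))\<^sup>2 \<le> \<eta>\<^sup>2"
    by (simp add: E_def power2_norm_eq_inner)
  then have "exp C * (exp (- C) * (norm (y 1))\<^sup>2) \<le> exp C * \<eta>\<^sup>2"
    by (intro mult_left_mono) auto
  then have "(norm (y 1))\<^sup>2 \<le> exp C * \<eta>\<^sup>2"
    by (simp add: mult.assoc[symmetric] exp_minus)
  also have "\<dots> \<le> (exp C * exp C) * \<eta>\<^sup>2"
    using assms(4) by (intro mult_right_mono) (auto simp: C_def exp_add[symmetric])
  also have "\<dots> = (\<eta> * exp C)\<^sup>2" by (simp add: power2_eq_square)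
  finally show ?thesis
    using assms(5) by (auto simp: C_def intro: power2_le_imp_le)
qed

text \<open>
  Picard iteration: the $n$-th iterate is bounded by $|x_0|(Kt)^n/n!$, so the Neumann series and the
  series of its derivatives converge uniformly on the unit interval.
\<close>

lemma linear_ode_solution:
  fixes L :: "real \<Rightarrow> 'a::banach \<Rightarrow>\<^sub>L 'a"
  assumes L: "continuous_on {0..1} L"
  obtains y where "y 0 = x0"
    "\<And>t. t \<in> {0..1} \<Longrightarrow> (y has_vector_derivative L t (y t)) (at t within {0..1})"
proof -
  have "bounded (L ` {0..1})" using L compact_continuous_image compact_imp_bounded by blast
  then obtain K where K: "\<And>t. t \<in> {0..1} \<Longrightarrow> norm (L t) \<le> K" "K > 0"
    unfolding bounded_pos by blast
  define p where "p = rec_nat (\<lambda>t. x0) (\<lambda>n g t. integral {0..t} (\<lambda>s. blinfun_apply (L s) (g s)))"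
  have p0: "p 0 = (\<lambda>t. x0)" and pS: "p (Suc n) = (\<lambda>t. integral {0..t} (\<lambda>s. L s (p n s)))" for n
    by (simp_all add: p_def)
  have cont: "continuous_on {0..1} (p n)" for n
  proof (induction n)
    case (Suc n)
    then show ?case unfolding pS
      by (intro indefinite_integral_continuous_1 integrable_continuous_real continuous_intros L)
  qed (simp add: p0)
  have cont': "continuous_on {0..1} (\<lambda>s. L s (p n s))" for n
    by (intro continuous_intros L cont)
  have der: "(p (Suc n) has_vector_derivative L t (p n t)) (at t within {0..1})"
    if "t \<in> {0..1}" for n t
    unfolding pS using integral_has_vector_derivative[OF cont' that] .
  have bound: "norm (p n t) \<le> norm x0 * (K * t) ^ n / fact n" if "t \<in> {0..1}" for n t
    using that
  proof (induction n arbitrary: t)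
    case (Suc n)
    have I: "((\<lambda>s. norm x0 * K ^ Suc n / fact n * s ^ n) has_integral
        norm x0 * K ^ Suc n / fact (Suc n) * t ^ Suc n - norm x0 * K ^ Suc n / fact (Suc n) * 0 ^ Suc n) {0..t}"
    proof (rule fundamental_theorem_of_calculus)
      fix s :: real
      have "((\<lambda>s. norm x0 * K ^ Suc n / fact (Suc n) * s ^ Suc n) has_real_derivative
          norm x0 * K ^ Suc n / fact (Suc n) * (real (Suc n) * s ^ n)) (at s within {0..t})"
        by (intro DERIV_cmult) (use DERIV_pow[of "Suc n"] in simp)
      moreover have "norm x0 * K ^ Suc n / fact (Suc n) * (real (Suc n) * s ^ n) =
          norm x0 * K ^ Suc n / fact n * s ^ n"
        by (simp add: fact_Suc divide_simps del: of_nat_Suc)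
      ultimately show "((\<lambda>s. norm x0 * K ^ Suc n / fact (Suc n) * s ^ Suc n) has_vector_derivative
          norm x0 * K ^ Suc n / fact n * s ^ n) (at s within {0..t})"
        by (simp only: has_real_derivative_iff_has_vector_derivative)
    qed (use Suc.prems in simp)
    have "norm (L s (p n s)) \<le> norm x0 * K ^ Suc n / fact n * s ^ n" if "s \<in> {0..t}" for s
    proof -
      have s: "s \<in> {0..1}" using that Suc.prems by auto
      have "norm (L s (p n s)) \<le> norm (L s) * norm (p n s)" by (rule norm_blinfun)
      also have "\<dots> \<le> K * (norm x0 * (K * s) ^ n / fact n)"
        using K s by (intro mult_mono Suc.IH) auto
      finally show ?thesis by (simp add: power_mult_distrib mult_ac)
    qed
    then have "norm (integral {0..t} (\<lambda>s. L s (p n s))) \<le>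
        integral {0..t} (\<lambda>s. norm x0 * K ^ Suc n / fact n * s ^ n)"
      using Suc.prems has_integral_integrable[OF I]
      by (intro integral_norm_bound_integral integrable_continuous_real
          continuous_on_subset[OF cont']) (auto intro!: continuous_intros)
    then show ?case
      unfolding integral_unique[OF I] by (simp add: pS power_mult_distrib mult_ac)
  qed (simp add: p0)
  have bound1: "norm (p n t) \<le> norm x0 * (K ^ n / fact n)" if "t \<in> {0..1}" for n t
  proof -
    have "norm x0 * (K * t) ^ n / fact n \<le> norm x0 * (K ^ n / fact n)"
      unfolding times_divide_eq_right[symmetric]
      using that K(2) by (intro mult_left_mono divide_right_mono power_mono) auto
    with bound[OF that, of n] show ?thesis by linarith
  qed
  have sm: "summable (\<lambda>n. norm x0 * (K ^ n / fact n))"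
    using summable_exp[of K] by (intro summable_mult) (simp add: divide_inverse mult.commute)
  define y where "y t = (\<Sum>n. p n t)" for t
  have unif: "uniform_limit {0..1} (\<lambda>n t. \<Sum>i<n. p i t) y sequentially"
    unfolding y_def by (rule Weierstrass_m_test[OF bound1 sm]) 
  have sums: "(\<lambda>n. p n t) sums y t" if "t \<in> {0..1}" for t
    unfolding sums_def using tendsto_uniform_limitI[OF unif that] .
  \<comment> \<open>the derivatives of the iterates\<close>
  define d where "d n t = (case n of 0 \<Rightarrow> 0 | Suc m \<Rightarrow> blinfun_apply (L t) (p m t))" for n t
  have sum_d: "(\<Sum>i<Suc n. d i t) = L t (\<Sum>i<n. p i t)" for n t
    by (simp add: sum.lessThan_Suc_shift d_def blinfun.sum_right del: sum.lessThan_Suc)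
  have "\<exists>g. \<forall>t\<in>{0..1}. (\<lambda>n. p n t) sums g t \<and> (g has_derivative (\<lambda>h. h *\<^sub>R L t (y t))) (at t within {0..1})"
  proof (rule has_derivative_series[where f' = "\<lambda>n t h. h *\<^sub>R d n t" and x = 0])
    show "(p n has_derivative (\<lambda>h. h *\<^sub>R d n t)) (at t within {0..1})" if "t \<in> {0..1}" for n t
      using der[OF that] by (cases n) (auto simp: d_def p0 has_vector_derivative_def)
    show "\<forall>\<^sub>F n in sequentially. \<forall>t\<in>{0..1}. \<forall>h. norm ((\<Sum>i<n. h *\<^sub>R d i t) - h *\<^sub>R L t (y t)) \<le> e * norm h"
      if "e > 0" for e
    proof -
      have "\<forall>\<^sub>F n in sequentially. \<forall>t\<in>{0..1}. dist (\<Sum>i<n. p i t) (y t) < e / K"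
        using uniform_limitD[OF unif] that K(2) by simp
      then have "\<forall>\<^sub>F n in sequentially. \<forall>t\<in>{0..1}. \<forall>h.
          norm ((\<Sum>i<Suc n. h *\<^sub>R d i t) - h *\<^sub>R L t (y t)) \<le> e * norm h"
      proof eventually_elim
        case (elim n)
        show ?case
        proof (intro ballI allI)
          fix t h :: real assume t: "t \<in> {0..1}"
          have "norm ((\<Sum>i<Suc n. h *\<^sub>R d i t) - h *\<^sub>R L t (y t)) =
              \<bar>h\<bar> * norm (L t ((\<Sum>i<n. p i t) - y t))"
            by (simp only: scaleR_right.sum[symmetric] sum_d scaleR_diff_right[symmetric]
                norm_scaleR blinfun.diff_right)
          also have "\<dots> \<le> \<bar>h\<bar> * (K * (e / K))"
            using elim t K
            by (intro mult_left_mono order.trans[OF norm_blinfun] mult_mono)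
              (auto simp: dist_norm intro: less_imp_le)
          finally show "norm ((\<Sum>i<Suc n. h *\<^sub>R d i t) - h *\<^sub>R L t (y t)) \<le> e * norm h"
            using K(2) by (simp add: mult.commute)
        qed
      qed
      then show ?thesis by (subst (asm) eventually_sequentially_Suc)
    qed
    show "(\<lambda>n. p n 0) sums y 0" using sums by simp
  qed auto
  then obtain g where g: "\<And>t. t \<in> {0..1} \<Longrightarrow> (\<lambda>n. p n t) sums g t"
    "\<And>t. t \<in> {0..1} \<Longrightarrow> (g has_derivative (\<lambda>h. h *\<^sub>R L t (y t))) (at t within {0..1})" by blast
  have gy: "g t = y t" if "t \<in> {0..1}" for t
    using g(1)[OF that] sums[OF that] sums_unique2 by blast
  have "p (Suc n) 0 = 0" for n by (simp add: pS)
  then have "(\<lambda>n. p n 0) = (\<lambda>n. if n = 0 then x0 else 0)"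
    by (auto simp: fun_eq_iff p0 gr0_conv_Suc)
  then have "(\<lambda>n. p n 0) sums x0" using sums_single[of 0 "\<lambda>_. x0"] by simp
  then have "g 0 = x0" using g(1)[of 0] sums_unique2 by fastforce
  moreover have "(g has_vector_derivative L t (g t)) (at t within {0..1})" if "t \<in> {0..1}" for t
    using g(2)[OF that] gy[OF that] by (simp add: has_vector_derivative_def)
  ultimately show ?thesis by (rule that)
qed

text \<open>
  First-order Taylor expansion with an error that is uniform over a compact set of base points.
  It makes the estimates along a whole ray possible in \<open>flat_convex\<close>.
\<close>

lemma uniform_linearization:
  fixes h :: "complex \<Rightarrow> 'b::real_normed_vector"
  assumes "open S" "compact K" "K \<subseteq> S" "Ck_on 1 S h" "\<epsilon> > 0"
  shows "\<exists>\<delta>>0. \<forall>w\<in>K. \<forall>k. norm k < \<delta> \<longrightarrow>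
    norm (h (w + k) - h w) \<le> \<epsilon> \<and>
    norm (h (w + k) - h w - (Re k *\<^sub>R dx h w + Im k *\<^sub>R dy h w)) \<le> \<epsilon> * norm k"
proof -
  obtain r where r: "r > 0" "(\<Union>x\<in>K. cball x r) \<subseteq> S"
    using compact_subset_open_imp_cball_epsilon_subset[OF assms(2,1,3)] by blast
  define K' where "K' = {x + y | x y. x \<in> K \<and> y \<in> cball 0 r}"
  have "compact K'" unfolding K'_def by (rule compact_sums[OF assms(2) compact_cball])
  have mem: "w + k \<in> K'" if "w \<in> K" "norm k \<le> r" for w k
    using that unfolding K'_def by force
  have "K' \<subseteq> S"
    unfolding K'_def using r(2) by (force simp: dist_norm)
  have C: "continuous_on S h" "continuous_on S (dx h)" "continuous_on S (dy h)"
    and d: "\<And>w. w \<in> S \<Longrightarrow> h differentiable (at w)"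
    using assms(4) Ck_on_Suc_imp[of 0 S h] by auto
  have U: "\<exists>\<delta>>0. \<forall>x\<in>K'. \<forall>y\<in>K'. dist y x < \<delta> \<longrightarrow> dist (f y) (f x) < e"
    if "continuous_on S f" "e > 0" for f :: "complex \<Rightarrow> 'b" and e :: real
    using compact_uniformly_continuous[OF continuous_on_subset[OF that(1) \<open>K' \<subseteq> S\<close>] \<open>compact K'\<close>] that(2)
    unfolding uniformly_continuous_on_def by blast
  obtain d1 where d1: "d1 > 0" "\<And>x y. x \<in> K' \<Longrightarrow> y \<in> K' \<Longrightarrow> dist y x < d1 \<Longrightarrow> dist (h y) (h x) < \<epsilon>"
    using U[OF C(1) \<open>\<epsilon> > 0\<close>] by blast
  obtain d2 where d2: "d2 > 0"
    "\<And>x y. x \<in> K' \<Longrightarrow> y \<in> K' \<Longrightarrow> dist y x < d2 \<Longrightarrow> dist (dx h y) (dx h x) < \<epsilon> / 2"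
    using U[OF C(2), of "\<epsilon> / 2"] \<open>\<epsilon> > 0\<close> by auto
  obtain d3 where d3: "d3 > 0"
    "\<And>x y. x \<in> K' \<Longrightarrow> y \<in> K' \<Longrightarrow> dist y x < d3 \<Longrightarrow> dist (dy h y) (dy h x) < \<epsilon> / 2"
    using U[OF C(3), of "\<epsilon> / 2"] \<open>\<epsilon> > 0\<close> by auto
  define \<delta> where "\<delta> = min r (min d1 (min d2 d3))"
  have "\<delta> > 0" using r d1 d2 d3 by (simp add: \<delta>_def)
  moreover have "norm (h (w + k) - h w) \<le> \<epsilon> \<and>
    norm (h (w + k) - h w - (Re k *\<^sub>R dx h w + Im k *\<^sub>R dy h w)) \<le> \<epsilon> * norm k"
    if w: "w \<in> K" and k: "norm k < \<delta>" for w k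
  proof
    have wK: "w \<in> K'" using mem[OF w, of 0] r(1) by simp
    show "norm (h (w + k) - h w) \<le> \<epsilon>"
      using d1(2)[OF wK mem[OF w, of k]] k by (simp add: \<delta>_def dist_norm)
    let ?T = "cball w (norm k)"
    let ?f' = "\<lambda>x v. Re v *\<^sub>R dx h x + Im v *\<^sub>R dy h x"
    have T: "x \<in> K'" "dist x w < d2" "dist x w < d3" if "x \<in> ?T" for x
      using mem[OF w, of "x - w"] that k by (auto simp: \<delta>_def dist_norm norm_minus_commute)
    have "norm (h (w + k) - h w - ?f' w (w + k - w)) \<le> norm (w + k - w) * \<epsilon>"
    proof (rule differentiable_bound_linearization[where S = ?T])
      show "w + t *\<^sub>R (w + k - w) \<in> ?T" if "t \<in> {0..1}" for t
        using that by (simp add: dist_norm mult_left_le_one_le)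
      show "(h has_derivative ?f' x) (at x within ?T)" if "x \<in> ?T" for x
        using has_derivative_dx_dy[OF d] T[OF that] \<open>K' \<subseteq> S\<close> has_derivative_at_withinI by blast
      show "onorm (?f' x - ?f' w) \<le> \<epsilon>" if "x \<in> ?T" for x
      proof (rule onorm_le)
        fix v :: complex
        have "norm ((?f' x - ?f' w) v) = norm (Re v *\<^sub>R (dx h x - dx h w) + Im v *\<^sub>R (dy h x - dy h w))"
          by (simp add: algebra_simps)
        also have "\<dots> \<le> \<bar>Re v\<bar> * norm (dx h x - dx h w) + \<bar>Im v\<bar> * norm (dy h x - dy h w)"
          by (intro norm_triangle_le) simp
        also have "\<dots> \<le> norm v * (\<epsilon> / 2) + norm v * (\<epsilon> / 2)"
          using d2(2)[OF wK T(1,2)] d3(2)[OF wK T(1,3)] that abs_Re_le_cmod abs_Im_le_cmod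
          by (intro add_mono mult_mono) (auto simp: dist_norm intro: less_imp_le)
        finally show "norm ((?f' x - ?f' w) v) \<le> \<epsilon> * norm v" by (simp add: algebra_simps)
      qed
    qed simp
    then show "norm (h (w + k) - h w - (Re k *\<^sub>R dx h w + Im k *\<^sub>R dy h w)) \<le> \<epsilon> * norm k"
      by (simp add: mult.commute)
  qed
  ultimately show ?thesis by blast
qed

section \<open>Integration of flat matrix-valued one-forms\<close>

lemma bounded_bilinear_matrix_mult:
  "bounded_bilinear ((**) :: complex^'n^'n \<Rightarrow> complex^'n^'n \<Rightarrow> complex^'n^'n)"
  unfolding bilinear_conv_bounded_bilinear[symmetric] bilinear_def linear_iff
  by (simp add: matrix_matrix_mult_def vec_eq_iff sum.distrib algebra_simps scaleR_sum_right)

interpretation matmul: bounded_bilinear "(**) :: complex^'n^'n \<Rightarrow> complex^'n^'n \<Rightarrow> complex^'n^'n"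
  by (rule bounded_bilinear_matrix_mult)

definition one_form :: "(complex \<Rightarrow> 'b::real_vector) \<Rightarrow> (complex \<Rightarrow> 'b) \<Rightarrow> complex \<Rightarrow> complex \<Rightarrow> 'b"
  where "one_form P R z v = Re v *\<^sub>R P z + Im v *\<^sub>R R z"

text \<open>
  Flatness is $P_y + RP = R_x + PR$ for the form $P\,dx + R\,dy$. Let $\varphi_z$ solve the equation
  $\varphi' = \varphi\,\omega(z - p)$ along the segment $c_z(t) = p + t(z - p)$ and put
  $F(z) = \varphi_z(1)$. To differentiate $F$, compare the solutions for $z$ and $z + h$ by the
  defect $E(t) = \varphi_{z+h}(t) - \varphi_z(t) - \varphi_z(t)\,t\,\omega_{c_z(t)}(h)$. Flatness is
  exactly what turns $E'$ into $E$ times a bounded matrix plus a term of size $o(|h|)$;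
  since $E(0) = 0$, Gronwall's inequality gives $E(1) = o(|h|)$, which is the
  differentiability of $F$ with the prescribed derivative.
\<close>

lemma flat_convex:
  fixes P R :: "complex \<Rightarrow> complex^'n^'n"
  assumes "open S" "convex S" "p \<in> S" "Ck_on 1 S P" "Ck_on 1 S R"
    and flat: "\<And>z. z \<in> S \<Longrightarrow> dy P z + R z ** P z = dx R z + P z ** R z"
  obtains F where "F p = mat 1"
    "\<And>z. z \<in> S \<Longrightarrow> (F has_derivative (\<lambda>v. F z ** one_form P R z v)) (at z)"
proof -
  define B where "B = one_form P R"
  \<comment> \<open>the derivative of $w \mapsto B_w(h)$ in the direction $k$\<close>
  define DB where "DB w k h = Re h *\<^sub>R (Re k *\<^sub>R dx P w + Im k *\<^sub>R dy P w)
    + Im h *\<^sub>R (Re k *\<^sub>R dx R w + Im k *\<^sub>R dy R w)" for w k h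
  have B_add: "B w (k + h) = B w k + B w h" for w k h
    by (simp add: B_def one_form_def algebra_simps)
  have B_scale: "B w (a *\<^sub>R h) = a *\<^sub>R B w h" for w a h
    by (simp add: B_def one_form_def algebra_simps)
  have DB_scale: "DB w (a *\<^sub>R k) h = a *\<^sub>R DB w k h" for w a k h
    by (simp add: DB_def algebra_simps)
  have DB_flat: "DB w k h + B w k ** B w h = DB w h k + B w h ** B w k" if "w \<in> S" for w k h
  proof -
    have "DB w k h + B w k ** B w h - (DB w h k + B w h ** B w k) =
        (Re h * Im k - Im h * Re k) *\<^sub>R (dy P w + R w ** P w - (dx R w + P w ** R w))"
      unfolding DB_def B_def one_form_def by (simp add: matmul.add_left matmul.add_right matmul.scaleR_left matmul.scaleR_right algebra_simps)
    also have "\<dots> = 0" using flat[OF that] by simp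
    finally show ?thesis by simp
  qed
  define c where "c z t = p + t *\<^sub>R (z - p)" for z and t :: real
  have cS: "c z t \<in> S" if "z \<in> S" "t \<in> {0..1}" for z t
  proof -
    have "(1 - t) *\<^sub>R p + t *\<^sub>R z \<in> S" using assms(2,3) that by (simp add: convexD_alt)
    then show ?thesis by (simp add: c_def algebra_simps)
  qed
  have P: "\<And>w. w \<in> S \<Longrightarrow> P differentiable (at w)" "continuous_on S P"
    and R: "\<And>w. w \<in> S \<Longrightarrow> R differentiable (at w)" "continuous_on S R"
    using assms(4,5) Ck_on_Suc_imp[of 0 S P] Ck_on_Suc_imp[of 0 S R] by auto
  have cc: "continuous_on {0..1} (c z)" for z unfolding c_def by (intro continuous_intros)
  have cP: "continuous_on {0..1} (\<lambda>t. P (c z t))" "continuous_on {0..1} (\<lambda>t. R (c z t))" if "z \<in> S" for z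
    using cS[OF that] by (auto intro!: continuous_on_compose2[OF P(2) cc] continuous_on_compose2[OF R(2) cc])
  define X where "X z t = B (c z t) (z - p)" for z t
  have cX: "continuous_on {0..1} (X z)" if "z \<in> S" for z
    unfolding X_def B_def one_form_def by (intro continuous_intros cP that)
  have "\<exists>y. y 0 = mat 1 \<and> (\<forall>t\<in>{0..1}. (y has_vector_derivative y t ** X z t) (at t within {0..1}))"
    if "z \<in> S" for z
  proof -
    define L :: "real \<Rightarrow> (complex^'n^'n) \<Rightarrow>\<^sub>L (complex^'n^'n)" where "L t = Blinfun (\<lambda>Y. Y ** X z t)" for t
    have L: "blinfun_apply (L t) = (\<lambda>Y. Y ** X z t)" for t
      unfolding L_def by (rule bounded_linear_Blinfun_apply[OF matmul.bounded_linear_left])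
    have "continuous_on {0..1} L"
      by (rule continuous_on_blinfun_componentwise)
        (unfold L, intro matmul.continuous_on continuous_on_const cX that)
    from linear_ode_solution[OF this, of "mat 1"] show ?thesis unfolding L by metis
  qed
  then obtain \<phi> where \<phi>0: "\<And>z. z \<in> S \<Longrightarrow> \<phi> z 0 = mat 1" and
    \<phi>: "\<And>z t. z \<in> S \<Longrightarrow> t \<in> {0..1} \<Longrightarrow> (\<phi> z has_vector_derivative \<phi> z t ** X z t) (at t within {0..1})"
    by metis
  obtain M where M: "M > 0" "\<And>(a :: complex^'n^'n) (b :: complex^'n^'n). norm (a ** b) \<le> norm a * norm b * M"
    using matmul.pos_bounded by metis
  define F where "F z = \<phi> z 1" for z
  have "F p = mat 1"
  proof -
    have X0: "X p t = 0" for t by (simp add: X_def B_def one_form_def)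
    have "((\<lambda>t. \<phi> p t - mat 1) has_vector_derivative 0) (at t within {0..1})" if "t \<in> {0..1}" for t
      using has_vector_derivative_diff[OF \<phi>[OF assms(3) that] has_vector_derivative_const[of "mat 1"]]
      by (simp add: X0 matmul.zero_right)
    then have "norm (\<phi> p 1 - mat 1) \<le> 0 * exp (2 * 0 + 1)"
      by (rule gronwall) (use \<phi>0[OF assms(3)] in auto)
    then show ?thesis by (simp add: F_def)
  qed
  moreover have "(F has_derivative (\<lambda>v. F z ** one_form P R z v)) (at z)" if z: "z \<in> S" for z
  proof -
    define v where "v = z - p"
    define K where "K = c z ` {0..1}"
    have K: "compact K" "K \<subseteq> S"
      using cS[OF z] by (auto simp: K_def intro: compact_continuous_image[OF cc])
    have cK: "c z t \<in> K" if "t \<in> {0..1}" for t using that by (simp add: K_def)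
    have "bounded ((\<lambda>t. P (c z t)) ` {0..1})" "bounded ((\<lambda>t. R (c z t)) ` {0..1})"
      using cP[OF z] by (auto intro: compact_imp_bounded compact_continuous_image)
    moreover have "continuous_on {0..1} (\<phi> z)"
      using \<phi>[OF z] has_vector_derivative_continuous continuous_on_eq_continuous_within by blast
    then have "bounded (\<phi> z ` {0..1})"
      by (auto intro: compact_imp_bounded compact_continuous_image)
    ultimately obtain bP bR b\<phi> where
      b: "bP > 0" "bR > 0" "b\<phi> > 0" "\<And>t. t \<in> {0..1} \<Longrightarrow> norm (P (c z t)) \<le> bP"
      "\<And>t. t \<in> {0..1} \<Longrightarrow> norm (R (c z t)) \<le> bR" "\<And>t. t \<in> {0..1} \<Longrightarrow> norm (\<phi> z t) \<le> b\<phi>"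
      unfolding bounded_pos by (metis image_eqI)
    define b where "b = bP + bR"
    have "b > 0" using b by (simp add: b_def)
    have nB: "norm (B w h) \<le> norm h * (norm (P w) + norm (R w))" for w h
    proof -
      have "norm (B w h) \<le> \<bar>Re h\<bar> * norm (P w) + \<bar>Im h\<bar> * norm (R w)"
        unfolding B_def one_form_def by (intro norm_triangle_le) simp
      also have "\<dots> \<le> norm h * norm (P w) + norm h * norm (R w)"
        by (intro add_mono mult_right_mono abs_Re_le_cmod abs_Im_le_cmod) auto
      finally show ?thesis by (simp add: algebra_simps)
    qed
    define C where "C = b\<phi> * (2 * (norm v + 1)) * M + b\<phi> * b * M * (2 * norm v + b + 2) * M"
    have "norm v + 1 > 0" "2 * norm v + b + 2 > 0"
      using norm_ge_zero[of v] \<open>b > 0\<close> by linarith+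
    then have "0 < b\<phi> * (2 * (norm v + 1)) * M" "0 < b\<phi> * b * M * (2 * norm v + b + 2) * M"
      using b(3) \<open>b > 0\<close> M(1) by (intro mult_pos_pos; simp)+
    then have "C > 0" unfolding C_def by (rule add_pos_pos)
    define k where "k = (b + 2) * (norm v + 1) * M"
    have "k \<ge> 0" using \<open>b > 0\<close> M(1) by (simp add: k_def)
    show ?thesis unfolding has_derivative_at_alt
    proof (intro conjI allI impI)
      show "bounded_linear (\<lambda>v. F z ** one_form P R z v)"
        unfolding one_form_def
        by (intro bounded_linear_compose[OF matmul.bounded_linear_right] bounded_linear_add
          bounded_linear_compose[OF bounded_linear_scaleR_left bounded_linear_Re]
          bounded_linear_compose[OF bounded_linear_scaleR_left bounded_linear_Im])
      fix e :: real assume "e > 0"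
      \<comment> \<open>small enough for the constant of Gronwall's inequality to be absorbed into $e$\<close>
      define \<epsilon> where "\<epsilon> = min 1 (e / (C * exp (2 * k + 1)))"
      have \<epsilon>: "0 < \<epsilon>" "\<epsilon> \<le> 1" "C * \<epsilon> * exp (2 * k + 1) \<le> e"
        using \<open>e > 0\<close> \<open>C > 0\<close> by (auto simp: \<epsilon>_def min_def field_simps)
      obtain dP where dP: "dP > 0" "\<And>w h. w \<in> K \<Longrightarrow> norm h < dP \<Longrightarrow> norm (P (w + h) - P w) \<le> \<epsilon> \<and>
        norm (P (w + h) - P w - (Re h *\<^sub>R dx P w + Im h *\<^sub>R dy P w)) \<le> \<epsilon> * norm h"
        using uniform_linearization[OF assms(1) K assms(4) \<epsilon>(1)] by metis
      obtain dR where dR: "dR > 0" "\<And>w h. w \<in> K \<Longrightarrow> norm h < dR \<Longrightarrow> norm (R (w + h) - R w) \<le> \<epsilon> \<and>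
        norm (R (w + h) - R w - (Re h *\<^sub>R dx R w + Im h *\<^sub>R dy R w)) \<le> \<epsilon> * norm h"
        using uniform_linearization[OF assms(1) K assms(5) \<epsilon>(1)] by metis
      obtain dS where dS: "dS > 0" "ball z dS \<subseteq> S" using assms(1) z open_contains_ball by blast
      define d where "d = min \<epsilon> (min dP (min dR dS))"
      have "d > 0" using \<epsilon> dP dR dS by (simp add: d_def)
      moreover have "norm (F y - F z - F z ** one_form P R z (y - z)) \<le> e * norm (y - z)"
        if y: "norm (y - z) < d" for y
      proof -
        define h where "h = y - z"
        have h: "norm h < \<epsilon>" "norm h < dP" "norm h < dR" "norm h < 1" and yS: "y \<in> S" and yz: "y = z + h"
          using y dS(2) \<epsilon>(2) by (auto simp: d_def h_def dist_norm norm_minus_commute)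
        define E where "E t = \<phi> y t - \<phi> z t - \<phi> z t ** (t *\<^sub>R B (c z t) h)" for t
        \<comment> \<open>the first-order error of $X$ in the direction $h$\<close>
        define G where "G t = X y t - X z t - B (c z t) h - t *\<^sub>R DB (c z t) h v" for t
        define E' where "E' t = E t ** X y t + (\<phi> z t ** G t + \<phi> z t ** (t *\<^sub>R B (c z t) h) ** (X y t - X z t))" for t
        have cy: "c y t = c z t + t *\<^sub>R h" for t by (simp add: c_def yz algebra_simps)
        have E: "(E has_vector_derivative E' t) (at t within {0..1})" if t: "t \<in> {0..1}" for t
        proof -
          have c': "(c z has_derivative (\<lambda>s. s *\<^sub>R v)) (at t within {0..1})"
            unfolding c_def v_def by (auto intro!: derivative_eq_intros)
          have B': "((\<lambda>t. t *\<^sub>R B (c z t) h) has_vector_derivative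
              B (c z t) h + t *\<^sub>R DB (c z t) v h) (at t within {0..1})"
            unfolding B_def one_form_def has_vector_derivative_def
            by (rule derivative_eq_intros refl has_derivative_compose[OF c'] has_derivative_dx_dy
                P R cS[OF z t])+
              (simp add: DB_def algebra_simps fun_eq_iff)
          note D = has_vector_derivative_diff[OF has_vector_derivative_diff[OF \<phi>[OF yS t] \<phi>[OF z t]]
            matmul.has_vector_derivative[OF \<phi>[OF z t] B']]
          have fl: "DB (c z t) v h + X z t ** B (c z t) h = DB (c z t) h v + B (c z t) h ** X z t"
            using DB_flat[OF cS[OF z t]] by (simp add: X_def v_def)
          have "\<phi> y t ** X y t - \<phi> z t ** X z t - (\<phi> z t ** (B (c z t) h + t *\<^sub>R DB (c z t) v h) +
              \<phi> z t ** X z t ** (t *\<^sub>R B (c z t) h)) =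
            \<phi> y t ** X y t - \<phi> z t ** X z t - \<phi> z t ** B (c z t) h
              - t *\<^sub>R (\<phi> z t ** (DB (c z t) v h + X z t ** B (c z t) h))"
            by (simp add: matmul.add_right matmul.scaleR_right algebra_simps matrix_mul_assoc)
          also have "\<dots> = E' t" unfolding fl
            unfolding E'_def E_def G_def by (simp add: matmul.add_left matmul.add_right matmul.diff_left matmul.diff_right matmul.scaleR_left matmul.scaleR_right algebra_simps matrix_mul_assoc)
          finally show ?thesis using D unfolding E_def by simp
        qed
        have est: "norm (E' t) \<le> k * norm (E t) + C * \<epsilon> * norm h" if t: "t \<in> {0..1}" for t
        proof -
          have th: "norm (t *\<^sub>R h) \<le> norm h" using t by (simp add: mult_left_le_one_le)
          have th': "norm (t *\<^sub>R h) < dP" "norm (t *\<^sub>R h) < dR" using th h by linarith+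
          note p = dP(2)[OF cK[OF t] th'(1)] and r = dR(2)[OF cK[OF t] th'(2)]
          have np: "norm (P (c y t)) \<le> bP + 1"
            using p b(4)[OF t] \<epsilon>(2) norm_triangle_ineq2[of "P (c y t)" "P (c z t)"] unfolding cy by linarith
          have nr: "norm (R (c y t)) \<le> bR + 1"
            using r b(5)[OF t] \<epsilon>(2) norm_triangle_ineq2[of "R (c y t)" "R (c z t)"] unfolding cy by linarith
          have X: "X y t = B (c y t) v + B (c y t) h" "X z t = B (c z t) v"
          proof -
            have "y - p = v + h" by (simp add: v_def yz)
            then show "X y t = B (c y t) v + B (c y t) h" unfolding X_def by (simp only: B_add)
            show "X z t = B (c z t) v" by (simp add: X_def v_def)
          qed
          have sumb: "norm (P (c y t)) + norm (R (c y t)) \<le> b + 2" using np nr by (simp add: b_def)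
          have nBy: "norm (B (c y t) x) \<le> norm x * (b + 2)" for x
            using nB[of "c y t" x] mult_left_mono[OF sumb norm_ge_zero[of x]] by linarith
          have nBz: "norm (B (c z t) x) \<le> norm x * b" for x
            using nB[of "c z t" x] mult_left_mono[OF add_mono[OF b(4,5)[OF t]] norm_ge_zero[of x]]
            by (simp add: b_def)
          have nX: "norm (X y t) \<le> (b + 2) * (norm v + 1)"
          proof -
            have "norm (X y t) \<le> norm v * (b + 2) + norm h * (b + 2)"
              unfolding X by (intro norm_triangle_le add_mono nBy)
            also have "\<dots> \<le> norm v * (b + 2) + 1 * (b + 2)"
              using h(4) \<open>b > 0\<close> by (intro add_left_mono mult_right_mono) auto
            finally show ?thesis by (simp add: algebra_simps)
          qed
          have diffB: "norm (B (c y t) x - B (c z t) x) \<le> norm x * (2 * \<epsilon>)" for x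
          proof -
            have eq: "B (c y t) x - B (c z t) x =
              Re x *\<^sub>R (P (c y t) - P (c z t)) + Im x *\<^sub>R (R (c y t) - R (c z t))"
              by (simp add: B_def one_form_def algebra_simps)
            have "norm (B (c y t) x - B (c z t) x) \<le>
                \<bar>Re x\<bar> * norm (P (c y t) - P (c z t)) + \<bar>Im x\<bar> * norm (R (c y t) - R (c z t))"
              unfolding eq by (intro norm_triangle_le) simp
            also have "\<dots> \<le> norm x * \<epsilon> + norm x * \<epsilon>"
              using p r by (intro add_mono mult_mono abs_Re_le_cmod abs_Im_le_cmod) (auto simp: cy)
            finally show ?thesis by (simp add: algebra_simps)
          qed
          have linB: "norm (B (c y t) v - B (c z t) v - t *\<^sub>R DB (c z t) h v) \<le> norm v * (2 * (\<epsilon> * norm h))"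
          proof -
            let ?p = "P (c y t) - P (c z t) - (Re (t *\<^sub>R h) *\<^sub>R dx P (c z t) + Im (t *\<^sub>R h) *\<^sub>R dy P (c z t))"
            let ?r = "R (c y t) - R (c z t) - (Re (t *\<^sub>R h) *\<^sub>R dx R (c z t) + Im (t *\<^sub>R h) *\<^sub>R dy R (c z t))"
            have eq: "B (c y t) v - B (c z t) v - t *\<^sub>R DB (c z t) h v = Re v *\<^sub>R ?p + Im v *\<^sub>R ?r"
              by (simp add: B_def one_form_def DB_def algebra_simps)
            have "norm (B (c y t) v - B (c z t) v - t *\<^sub>R DB (c z t) h v) \<le>
                \<bar>Re v\<bar> * norm ?p + \<bar>Im v\<bar> * norm ?r"
              unfolding eq by (intro norm_triangle_le) simp
            also have "\<dots> \<le> norm v * (\<epsilon> * norm (t *\<^sub>R h)) + norm v * (\<epsilon> * norm (t *\<^sub>R h))"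
              using p r by (intro add_mono mult_mono abs_Re_le_cmod abs_Im_le_cmod) (simp_all add: cy)
            also have "\<dots> \<le> norm v * (\<epsilon> * norm h) + norm v * (\<epsilon> * norm h)"
              using th \<epsilon>(1) by (intro add_mono mult_left_mono) auto
            finally show ?thesis by (simp add: algebra_simps)
          qed
          have nG: "norm (G t) \<le> \<epsilon> * norm h * (2 * (norm v + 1))"
          proof -
            have "G t = (B (c y t) v - B (c z t) v - t *\<^sub>R DB (c z t) h v) + (B (c y t) h - B (c z t) h)"
              by (simp add: G_def X)
            also have "norm \<dots> \<le> norm v * (2 * (\<epsilon> * norm h)) + norm h * (2 * \<epsilon>)"
              by (intro norm_triangle_le add_mono linB diffB)
            finally show ?thesis by (simp add: algebra_simps)
          qed
          have nXX: "norm (X y t - X z t) \<le> \<epsilon> * (2 * norm v + b + 2)"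
          proof -
            have "X y t - X z t = (B (c y t) v - B (c z t) v) + B (c y t) h" by (simp add: X)
            also have "norm \<dots> \<le> norm v * (2 * \<epsilon>) + norm h * (b + 2)"
              by (intro norm_triangle_le add_mono diffB nBy)
            also have "\<dots> \<le> norm v * (2 * \<epsilon>) + \<epsilon> * (b + 2)"
              using h(1) \<open>b > 0\<close> by (intro add_left_mono mult_right_mono) auto
            finally show ?thesis by (simp add: algebra_simps)
          qed
          have ntB: "norm (t *\<^sub>R B (c z t) h) \<le> norm h * b"
            using mult_mono[OF _ nBz[of h], of "\<bar>t\<bar>" 1] t by simp
          note le = order.trans[OF M(2)]
          have "norm (E t ** X y t) \<le> norm (E t) * ((b + 2) * (norm v + 1)) * M"
            using M(1) by (intro le mult_right_mono mult_left_mono nX) auto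
          moreover have "norm (\<phi> z t ** G t) \<le> b\<phi> * (\<epsilon> * norm h * (2 * (norm v + 1))) * M"
            using M(1) b by (intro le mult_right_mono mult_mono nG b(6) t) auto
          moreover
          have n1: "norm (\<phi> z t ** (t *\<^sub>R B (c z t) h)) \<le> b\<phi> * (norm h * b) * M"
            using M(1) b by (intro le mult_right_mono mult_mono ntB b(6) t) auto
          then have "norm (\<phi> z t ** (t *\<^sub>R B (c z t) h) ** (X y t - X z t)) \<le>
              (b\<phi> * (norm h * b) * M) * (\<epsilon> * (2 * norm v + b + 2)) * M"
            using M(1) b \<open>b > 0\<close>
            by (intro le[OF mult_right_mono[OF mult_mono[OF n1 nXX]]]) auto
          ultimately have "norm (E' t) \<le> norm (E t) * ((b + 2) * (norm v + 1)) * M +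
             (b\<phi> * (\<epsilon> * norm h * (2 * (norm v + 1))) * M +
              (b\<phi> * (norm h * b) * M) * (\<epsilon> * (2 * norm v + b + 2)) * M)"
            unfolding E'_def by (intro norm_triangle_le add_mono)
          also have "\<dots> = k * norm (E t) + C * \<epsilon> * norm h"
            by (simp add: k_def C_def algebra_simps)
          finally show ?thesis .
        qed
        have "norm (E 1) \<le> C * \<epsilon> * norm h * exp (2 * k + 1)"
          using \<phi>0[OF yS] \<phi>0[OF z] \<open>C > 0\<close> \<epsilon>(1) \<open>k \<ge> 0\<close>
          by (intro gronwall[of E E'] E est) (auto simp: E_def matmul.zero_right)
        also have "\<dots> = (C * \<epsilon> * exp (2 * k + 1)) * norm h" by simp
        also have "\<dots> \<le> e * norm h" by (intro mult_right_mono \<epsilon>(3)) simp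
        finally show ?thesis by (simp add: E_def F_def h_def B_def c_def)
      qed
      ultimately show "\<exists>d>0. \<forall>y. norm (y - z) < d \<longrightarrow>
          norm (F y - F z - F z ** one_form P R z (y - z)) \<le> e * norm (y - z)" by blast
    qed
  qed
  ultimately show ?thesis by (rule that)
qed


text \<open>
  The Riemann map identifies the domain with the plane or with the unit disc. The pull-back of a
  form along a holomorphic $g$ with derivative $a + ib$ has the coefficients $aP + bR$ and $aR - bP$
  at the image point, and its curvature is $a^2 + b^2$ times the curvature there.
\<close>

lemma flat_simply_connected:
  fixes P R :: "complex \<Rightarrow> complex^'n^'n"
  assumes "open S" "simply_connected S" "p \<in> S" "Ck_on 1 S P" "Ck_on 1 S R"
    and flat: "\<And>z. z \<in> S \<Longrightarrow> dy P z + R z ** P z = dx R z + P z ** R z"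
  obtains F where "F p = mat 1"
    "\<And>z. z \<in> S \<Longrightarrow> (F has_derivative (\<lambda>v. F z ** one_form P R z v)) (at z)"
proof -
  consider "S = UNIV" | f g where "f holomorphic_on S" "g holomorphic_on ball 0 1"
    "\<And>z. z \<in> S \<Longrightarrow> f z \<in> ball 0 1" "\<And>z. z \<in> S \<Longrightarrow> g (f z) = z"
    "\<And>z. z \<in> ball 0 1 \<Longrightarrow> g z \<in> S"
    using simply_connected_eq_biholomorphic_to_disc[OF assms(1)] assms(2,3) by auto
  then show ?thesis
  proof cases
    case 1
    then have "convex S" by simp
    show ?thesis using flat_convex[OF assms(1) \<open>convex S\<close> assms(3-5) flat] that by blast
  next
    case (2 f g)
    define a where "a w = Re (deriv g w)" for w
    define b where "b w = Im (deriv g w)" for w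
    define P' where "P' w = a w *\<^sub>R P (g w) + b w *\<^sub>R R (g w)" for w
    define R' where "R' w = a w *\<^sub>R R (g w) + (- b w) *\<^sub>R P (g w)" for w
    let ?U = "ball 0 1 :: complex set"
    have g: "(g has_field_derivative deriv g w) (at w)" if "w \<in> ?U" for w
      using 2(2) that holomorphic_derivI by blast
    have hol: "deriv g holomorphic_on ?U" using 2(2) holomorphic_deriv by blast
    then have g2: "(deriv g has_field_derivative deriv (deriv g) w) (at w)" if "w \<in> ?U" for w
      using that holomorphic_derivI by blast
    have Ca: "Ck_on n ?U a" and Cb: "Ck_on n ?U b" and Cb': "Ck_on n ?U (\<lambda>w. - b w)" for n
      unfolding a_def b_def
      by (intro Ck_on_bounded_linear[OF bounded_linear_Re] Ck_on_bounded_linear[OF bounded_linear_Im]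
          Ck_on_bounded_linear[OF bounded_linear_minus[OF bounded_linear_ident]]
          Ck_on_holomorphic hol open_ball)+
    have CP: "Ck_on 1 ?U (\<lambda>w. P (g w))" and CR: "Ck_on 1 ?U (\<lambda>w. R (g w))"
      using 2(5) by (intro Ck_on_holomorphic_chain[OF open_ball 2(2) _ assms(4)]
          Ck_on_holomorphic_chain[OF open_ball 2(2) _ assms(5)]; blast)+
    have CP': "Ck_on 1 ?U P'" and CR': "Ck_on 1 ?U R'"
      unfolding P'_def R'_def
      by (intro Ck_on_add Ck_on_bilinear[OF bounded_bilinear_scaleR] open_ball Ca Cb Cb' CP CR)+
    have flat': "dy P' w + R' w ** P' w = dx R' w + P' w ** R' w" if w: "w \<in> ?U" for w
    proof -
      have dP: "P differentiable (at (g w))" and dR: "R differentiable (at (g w))"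
        using assms(4,5) 2(5)[OF w] by auto
      note dPg = has_derivative_dx_dy[OF differentiable_holomorphic_chain[OF dP g[OF w]]]
        and dRg = has_derivative_dx_dy[OF differentiable_holomorphic_chain[OF dR g[OF w]]]
      have da: "(a has_derivative (\<lambda>v. Re (v * deriv (deriv g) w))) (at w)"
        and db: "(b has_derivative (\<lambda>v. Im (v * deriv (deriv g) w))) (at w)"
        unfolding a_def b_def
        using bounded_linear.has_derivative[OF bounded_linear_Re g2[OF w, unfolded has_field_derivative_def]]
          bounded_linear.has_derivative[OF bounded_linear_Im g2[OF w, unfolded has_field_derivative_def]]
        by (simp_all add: mult.commute)
      have dyP': "dy P' w = a w *\<^sub>R dy (\<lambda>w. P (g w)) w + Re (\<i> * deriv (deriv g) w) *\<^sub>R P (g w)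
          + (b w *\<^sub>R dy (\<lambda>w. R (g w)) w + Im (\<i> * deriv (deriv g) w) *\<^sub>R R (g w))"
        using dy_eqI[OF has_derivative_add[OF has_derivative_scaleR[OF da dPg]
          has_derivative_scaleR[OF db dRg]]] unfolding P'_def[abs_def] by simp
      have dxR': "dx R' w = a w *\<^sub>R dx (\<lambda>w. R (g w)) w + Re (deriv (deriv g) w) *\<^sub>R R (g w)
          + (- b w *\<^sub>R dx (\<lambda>w. P (g w)) w + (- Im (deriv (deriv g) w)) *\<^sub>R P (g w))"
        using dx_eqI[OF has_derivative_add[OF has_derivative_scaleR[OF da dRg]
          has_derivative_scaleR[OF has_derivative_minus[OF db] dPg]]] unfolding R'_def[abs_def] by simp
      have "dy P' w + R' w ** P' w - (dx R' w + P' w ** R' w) =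
        (a w * a w + b w * b w) *\<^sub>R (dy P (g w) + R (g w) ** P (g w) - (dx R (g w) + P (g w) ** R (g w)))"
        unfolding dyP' dxR' dx_holomorphic_chain[OF dP g[OF w]] dx_holomorphic_chain[OF dR g[OF w]]
          dy_holomorphic_chain[OF dP g[OF w]] dy_holomorphic_chain[OF dR g[OF w]]
          a_def[symmetric] b_def[symmetric]
        by (simp add: P'_def R'_def matmul.add_left matmul.add_right matmul.diff_left matmul.diff_right
            matmul.scaleR_left matmul.scaleR_right matmul.minus_left matmul.minus_right algebra_simps)
      also have "\<dots> = 0" using flat[OF 2(5)[OF w]] by simp
      finally show ?thesis by simp
    qed
    obtain F where F: "F (f p) = mat 1"
      "\<And>w. w \<in> ?U \<Longrightarrow> (F has_derivative (\<lambda>v. F w ** one_form P' R' w v)) (at w)"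
      using flat_convex[OF open_ball convex_ball 2(3)[OF assms(3)] CP' CR' flat'] by blast
    show ?thesis
    proof (rule that[of "\<lambda>z. F (f z)"])
      fix z assume z: "z \<in> S"
      have f: "(f has_field_derivative deriv f z) (at z)"
        using 2(1) assms(1) z holomorphic_derivI by blast
      have "((\<lambda>w. g (f w)) has_field_derivative deriv g (f z) * deriv f z) (at z)"
        using DERIV_chain2[OF g f] 2(3)[OF z] by blast
      moreover have "((\<lambda>w. g (f w)) has_field_derivative 1) (at z)"
        by (rule has_field_derivative_transform_within_open[OF DERIV_ident assms(1) z]) (simp add: 2(4))
      ultimately have gf: "deriv g (f z) * deriv f z = 1" by (rule DERIV_unique)
      have "one_form P' R' (f z) (deriv f z * v) = one_form P R z v" for v
      proof -
        define q where "q = deriv f z * v"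
        have "v = deriv g (f z) * q" using gf by (simp add: q_def mult.assoc[symmetric])
        then have reim: "Re v = a (f z) * Re q - b (f z) * Im q" "Im v = a (f z) * Im q + b (f z) * Re q"
          by (simp_all add: a_def b_def)
        show ?thesis
          unfolding q_def[symmetric] one_form_def P'_def R'_def 2(4)[OF z] reim
          by (simp add: algebra_simps)
      qed
      with has_derivative_compose[OF f[unfolded has_field_derivative_def] F(2)[OF 2(3)[OF z]]]
      show "((\<lambda>z. F (f z)) has_derivative (\<lambda>v. F (f z) ** one_form P R z v)) (at z)" by simp
    qed (rule F(1))
  qed
qed

section \<open>Frames of $\mathfrak{su}(2)$-valued flat forms and their harmonic Gauss maps\<close>

lemma i_i [simp]: "\<i> * (\<i> * x) = - x" by (simp add: mult.assoc[symmetric])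

lemma cmod_square_cnj: "(complex_of_real (cmod w))\<^sup>2 = w * cnj w"
  by (metis complex_norm_square of_real_power)

lemma bounded_linear_mat22_entries:
  "bounded_linear (\<lambda>a :: complex. mat22 a 0 0 0)" "bounded_linear (\<lambda>a :: complex. mat22 0 a 0 0)"
  "bounded_linear (\<lambda>a :: complex. mat22 0 0 a 0)" "bounded_linear (\<lambda>a :: complex. mat22 0 0 0 a)"
  unfolding linear_conv_bounded_linear[symmetric] linear_iff by (simp_all add: vec_eq_iff forall_2)

lemma mat22_split: "mat22 a b c (d :: complex) = mat22 a 0 0 0 + mat22 0 b 0 0 + mat22 0 0 c 0 + mat22 0 0 0 d"
  by (simp add: vec_eq_iff forall_2)

lemma mat22_ops:
  fixes a b c d :: complex
  shows "mat22 a b c d ** mat22 a' b' c' d' =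
      mat22 (a * a' + b * c') (a * b' + b * d') (c * a' + d * c') (c * b' + d * d')"
    and "mat22 a b c d + mat22 a' b' c' d' = mat22 (a + a') (b + b') (c + c') (d + d')"
    and "mat22 a b c d - mat22 a' b' c' d' = mat22 (a - a') (b - b') (c - c') (d - d')"
    and "t *\<^sub>R mat22 a b c d = mat22 (t *\<^sub>R a) (t *\<^sub>R b) (t *\<^sub>R c) (t *\<^sub>R d)"
    and "adj (mat22 a b c d) = mat22 (cnj a) (cnj c) (cnj b) (cnj d)"
  by (simp_all add: vec_eq_iff forall_2 matrix_matrix_mult_def sum_2 adj_def)

lemma mat22_eq_iff: "mat22 a b c d = mat22 a' b' c' d' \<longleftrightarrow> a = a' \<and> b = b' \<and> c = c' \<and> d = d'"
  by (auto simp: vec_eq_iff forall_2)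

lemma Ck_on_mat22:
  fixes a b c d :: "complex \<Rightarrow> complex"
  assumes "open D" "Ck_on n D a" "Ck_on n D b" "Ck_on n D c" "Ck_on n D d"
  shows "Ck_on n D (\<lambda>z. mat22 (a z) (b z) (c z) (d z))"
  by (subst mat22_split) (intro Ck_on_add assms bounded_linear_mat22_entries[THEN Ck_on_bounded_linear])

lemma
  fixes a b c d :: "complex \<Rightarrow> complex"
  assumes "a differentiable (at z)" "b differentiable (at z)" "c differentiable (at z)" "d differentiable (at z)"
  shows dx_mat22: "dx (\<lambda>z. mat22 (a z) (b z) (c z) (d z)) z = mat22 (dx a z) (dx b z) (dx c z) (dx d z)"
    and dy_mat22: "dy (\<lambda>z. mat22 (a z) (b z) (c z) (d z)) z = mat22 (dy a z) (dy b z) (dy c z) (dy d z)"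
proof -
  have "((\<lambda>z. mat22 (a z) 0 0 0 + mat22 0 (b z) 0 0 + mat22 0 0 (c z) 0 + mat22 0 0 0 (d z)) has_derivative
    (\<lambda>v. mat22 (Re v *\<^sub>R dx a z + Im v *\<^sub>R dy a z) 0 0 0 + mat22 0 (Re v *\<^sub>R dx b z + Im v *\<^sub>R dy b z) 0 0
      + mat22 0 0 (Re v *\<^sub>R dx c z + Im v *\<^sub>R dy c z) 0 + mat22 0 0 0 (Re v *\<^sub>R dx d z + Im v *\<^sub>R dy d z))) (at z)"
    by (intro has_derivative_add bounded_linear_mat22_entries[THEN bounded_linear.has_derivative]
        has_derivative_dx_dy assms)
  then have *: "((\<lambda>z. mat22 (a z) (b z) (c z) (d z)) has_derivative
    (\<lambda>v. mat22 (Re v *\<^sub>R dx a z + Im v *\<^sub>R dy a z) (Re v *\<^sub>R dx b z + Im v *\<^sub>R dy b z)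
      (Re v *\<^sub>R dx c z + Im v *\<^sub>R dy c z) (Re v *\<^sub>R dx d z + Im v *\<^sub>R dy d z))) (at z)"
    by (simp add: mat22_split[symmetric])
  show "dx (\<lambda>z. mat22 (a z) (b z) (c z) (d z)) z = mat22 (dx a z) (dx b z) (dx c z) (dx d z)"
    "dy (\<lambda>z. mat22 (a z) (b z) (c z) (d z)) z = mat22 (dy a z) (dy b z) (dy c z) (dy d z)"
    using dx_eqI[OF *] dy_eqI[OF *] by simp_all
qed

lemma bounded_linear_adj: "bounded_linear adj"
  unfolding linear_conv_bounded_linear[symmetric] linear_iff
  by (simp add: vec_eq_iff adj_def)

lemma adj_mult: "adj (a ** b) = adj b ** adj a"
  by (simp add: vec_eq_iff adj_def matrix_matrix_mult_def mult.commute)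

lemma adj_mat_1 [simp]: "adj (mat 1) = mat 1"
  by (simp add: vec_eq_iff adj_def mat_def)

text \<open>
  For skew-Hermitian $\omega$ both frames contribute to the derivative, and the two contributions
  combine to a commutator with $K$. The case $K = 1$ gives uniqueness of frames, the case
  $K = \sigma_3$ the derivative of the Gauss map, and a nonconstant $K$ the second derivatives of
  the Gauss map.
\<close>

lemma has_derivative_conjugation:
  fixes F K :: "complex \<Rightarrow> complex^2^2"
  assumes F: "(F has_derivative (\<lambda>v. F z ** \<omega> v)) (at z)"
    and G: "(G has_derivative (\<lambda>v. G z ** \<omega> v)) (at z)"
    and K: "(K has_derivative K') (at z)"
    and "\<And>v. adj (\<omega> v) = - \<omega> v"
  shows "((\<lambda>w. F w ** K w ** adj (G w)) has_derivative
    (\<lambda>v. F z ** (\<omega> v ** K z - K z ** \<omega> v + K' v) ** adj (G z))) (at z)"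
proof -
  have "((\<lambda>w. F w ** K w ** adj (G w)) has_derivative
    (\<lambda>v. (F z ** K z) ** adj (G z ** \<omega> v) + (F z ** K' v + (F z ** \<omega> v) ** K z) ** adj (G z))) (at z)"
    by (intro matmul.FDERIV F K bounded_linear.has_derivative[OF bounded_linear_adj G])
  moreover have "(F z ** K z) ** adj (G z ** \<omega> v) + (F z ** K' v + (F z ** \<omega> v) ** K z) ** adj (G z) =
      F z ** (\<omega> v ** K z - K z ** \<omega> v + K' v) ** adj (G z)" for v
    by (simp add: adj_mult assms(4) matmul.add_left matmul.add_right matmul.diff_left matmul.diff_right
        matmul.minus_left matmul.minus_right matrix_mul_assoc)
  ultimately show ?thesis by simp
qed

text \<open>
  By \<open>has_derivative_conjugation\<close> with $K = 1$ the product $FG^*$ has derivative zero, for any two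
  frames of the same form. Applied to $F = G$ this is unitarity.
\<close>

lemma frames_agree:
  fixes F G :: "complex \<Rightarrow> complex^2^2"
  assumes "open D" "connected D" "p \<in> D" "F p = mat 1" "G p = mat 1"
    and F: "\<And>z. z \<in> D \<Longrightarrow> (F has_derivative (\<lambda>v. F z ** \<omega> z v)) (at z)"
    and G: "\<And>z. z \<in> D \<Longrightarrow> (G has_derivative (\<lambda>v. G z ** \<omega> z v)) (at z)"
    and skew: "\<And>z v. z \<in> D \<Longrightarrow> adj (\<omega> z v) = - \<omega> z v"
    and "z \<in> D"
  shows "F z ** adj (G z) = mat 1" "F z = G z"
proof -
  have one: "F z ** adj (G z) = mat 1"
    if F0: "F p = mat 1" and G0: "G p = mat 1"
      and F: "\<And>z. z \<in> D \<Longrightarrow> (F has_derivative (\<lambda>v. F z ** \<omega> z v)) (at z)"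
      and G: "\<And>z. z \<in> D \<Longrightarrow> (G has_derivative (\<lambda>v. G z ** \<omega> z v)) (at z)" for F G
  proof -
    have "F z ** mat 1 ** adj (G z) = F p ** mat 1 ** adj (G p)"
    proof (rule has_derivative_zero_unique_connected[OF assms(1,2) _ \<open>z \<in> D\<close> \<open>p \<in> D\<close>])
      fix w assume w: "w \<in> D"
      show "((\<lambda>w. F w ** mat 1 ** adj (G w)) has_derivative (\<lambda>v. 0)) (at w)"
        using has_derivative_conjugation[OF F[OF w] G[OF w] has_derivative_const skew[OF w], of "mat 1"]
        by (simp add: matmul.zero_left matmul.zero_right)
    qed
    then show ?thesis by (simp add: F0 G0)
  qed
  show "F z ** adj (G z) = mat 1" by (rule one) fact+
  have "adj (G z) ** G z = mat 1"
    using one[OF assms(5,5) G G] matrix_left_right_inverse by blast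
  then have "F z = F z ** adj (G z) ** G z" by (simp add: matrix_mul_assoc[symmetric])
  also have "\<dots> = G z" using one[OF assms(4,5) F G] by simp
  finally show "F z = G z" .
qed

text \<open>
  Jacobi's formula: the derivative of the determinant is the determinant times the trace of the
  form, which vanishes.
\<close>

lemma det_frame:
  fixes F :: "complex \<Rightarrow> complex^2^2"
  assumes "open D" "connected D" "p \<in> D" "F p = mat 1"
    and F: "\<And>z. z \<in> D \<Longrightarrow> (F has_derivative (\<lambda>v. F z ** \<omega> z v)) (at z)"
    and tr: "\<And>z v. z \<in> D \<Longrightarrow> \<omega> z v $ 2 $ 2 = - (\<omega> z v $ 1 $ 1)"
    and "z \<in> D"
  shows "det (F z) = 1"
proof -
  have "det (F z) = det (F p)"
  proof (rule has_derivative_zero_unique_connected[OF assms(1,2) _ \<open>z \<in> D\<close> \<open>p \<in> D\<close>])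
    fix w assume w: "w \<in> D"
    have e: "((\<lambda>x. F x $ i $ j) has_derivative (\<lambda>v. (F w ** \<omega> w v) $ i $ j)) (at w)" for i j
      by (intro bounded_linear.has_derivative[OF bounded_linear_vec_nth] F w)
    have "((\<lambda>x. F x $ 1 $ 1 * F x $ 2 $ 2 - F x $ 1 $ 2 * F x $ 2 $ 1) has_derivative
      (\<lambda>v. (F w $ 1 $ 1 * (F w ** \<omega> w v) $ 2 $ 2 + (F w ** \<omega> w v) $ 1 $ 1 * F w $ 2 $ 2) -
        (F w $ 1 $ 2 * (F w ** \<omega> w v) $ 2 $ 1 + (F w ** \<omega> w v) $ 1 $ 2 * F w $ 2 $ 1))) (at w)"
      by (intro has_derivative_diff has_derivative_mult e)
    moreover have "(F w $ 1 $ 1 * (F w ** \<omega> w v) $ 2 $ 2 + (F w ** \<omega> w v) $ 1 $ 1 * F w $ 2 $ 2) -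
        (F w $ 1 $ 2 * (F w ** \<omega> w v) $ 2 $ 1 + (F w ** \<omega> w v) $ 1 $ 2 * F w $ 2 $ 1) = 0" for v
      by (simp add: matrix_matrix_mult_def sum_2 tr[OF w] algebra_simps)
    ultimately show "((\<lambda>x. det (F x)) has_derivative (\<lambda>v. 0)) (at w)" by (simp add: det_2)
  qed
  then show ?thesis by (simp add: assms(4))
qed

text \<open>
  Bootstrapping: the partial derivatives of $F$ are $F$ times smooth coefficients.
\<close>

lemma Ck_on_frame:
  fixes F P R :: "complex \<Rightarrow> complex^'n^'n"
  assumes "open D" "\<And>n. Ck_on n D P" "\<And>n. Ck_on n D R"
    and F: "\<And>z. z \<in> D \<Longrightarrow> (F has_derivative (\<lambda>v. F z ** one_form P R z v)) (at z)"
  shows "Ck_on n D F"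
proof (induction n)
  case 0
  have "isCont F z" if "z \<in> D" for z using has_derivative_continuous[OF F[OF that]] .
  then show ?case by (simp add: continuous_at_imp_continuous_on)
next
  case (Suc n)
  have "Ck_on n D (dx F)"
    by (rule Ck_on_cong[OF assms(1), THEN iffD2,
          OF _ Ck_on_bilinear[OF bounded_bilinear_matrix_mult assms(1) Suc assms(2)]])
      (simp add: dx_eqI[OF F] one_form_def)
  moreover have "Ck_on n D (dy F)"
    by (rule Ck_on_cong[OF assms(1), THEN iffD2,
          OF _ Ck_on_bilinear[OF bounded_bilinear_matrix_mult assms(1) Suc assms(3)]])
      (simp add: dy_eqI[OF F] one_form_def)
  ultimately show ?case using F by (auto simp: differentiable_def)
qed

text \<open>
  The coefficients $A - A^*$ and $i(A + A^*)$ of $dx$ and $dy$ in the form $A\,dz - A^*\,d\bar z$, where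
  $A$ has the rows $(-\upsilon, q)$ and $(r, \upsilon)$.
\<close>

definition Omega_x :: "(complex \<Rightarrow> complex) \<Rightarrow> (complex \<Rightarrow> complex) \<Rightarrow> (complex \<Rightarrow> complex) \<Rightarrow> complex \<Rightarrow> complex^2^2"
  where "Omega_x \<upsilon> q r z = mat22 (cnj (\<upsilon> z) - \<upsilon> z) (q z - cnj (r z)) (r z - cnj (q z)) (\<upsilon> z - cnj (\<upsilon> z))"

definition Omega_y :: "(complex \<Rightarrow> complex) \<Rightarrow> (complex \<Rightarrow> complex) \<Rightarrow> (complex \<Rightarrow> complex) \<Rightarrow> complex \<Rightarrow> complex^2^2"
  where "Omega_y \<upsilon> q r z = mat22 (- \<i> * (\<upsilon> z + cnj (\<upsilon> z))) (\<i> * (q z + cnj (r z)))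
    (\<i> * (r z + cnj (q z))) (\<i> * (\<upsilon> z + cnj (\<upsilon> z)))"

lemma one_form_skew:
  "adj (one_form (Omega_x \<upsilon> q r) (Omega_y \<upsilon> q r) z v) = - one_form (Omega_x \<upsilon> q r) (Omega_y \<upsilon> q r) z v"
  "one_form (Omega_x \<upsilon> q r) (Omega_y \<upsilon> q r) z v $ 2 $ 2 = - (one_form (Omega_x \<upsilon> q r) (Omega_y \<upsilon> q r) z v $ 1 $ 1)"
  by (simp_all add: one_form_def Omega_x_def Omega_y_def vec_eq_iff forall_2 adj_def algebra_simps)

text \<open>
  The diagonal part of the zero curvature equation for $A\,dz - A^*\,d\bar z$ is the last equation.
  The off-diagonal part is a single equation that couples $q$ and $r$; requiring it separately for
  $q$ and for $r$ is the harmonic map equation for the Gauss map.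
\<close>

locale harmonic_data =
  fixes D :: "complex set" and \<upsilon> q r :: "complex \<Rightarrow> complex"
  assumes D: "open D" "simply_connected D" "0 \<in> D"
    and smooth: "\<And>n. Ck_on n D \<upsilon>" "\<And>n. Ck_on n D q" "\<And>n. Ck_on n D r"
    and q_zbar: "\<And>z. z \<in> D \<Longrightarrow> d_zbar q z = - 2 * cnj (\<upsilon> z) * q z"
    and r_zbar: "\<And>z. z \<in> D \<Longrightarrow> d_zbar r z = 2 * cnj (\<upsilon> z) * r z"
    and \<upsilon>_zbar: "\<And>z. z \<in> D \<Longrightarrow> d_zbar \<upsilon> z + cnj (d_zbar \<upsilon> z) = q z * cnj (q z) - r z * cnj (r z)"
begin

abbreviation "P \<equiv> Omega_x \<upsilon> q r"
abbreviation "R \<equiv> Omega_y \<upsilon> q r"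

lemma Ck_cnj: "Ck_on n D h \<Longrightarrow> Ck_on n D (\<lambda>z. cnj (h z))"
  by (rule Ck_on_bounded_linear[OF bounded_linear_cnj D(1)])

lemma Ck_on_PR: "Ck_on n D P" "Ck_on n D R"
proof -
  note m = Ck_on_bounded_linear[OF bounded_linear_mult_right D(1)]
  note neg = Ck_on_bounded_linear[OF bounded_linear_minus[OF bounded_linear_ident] D(1)]
  show "Ck_on n D P" unfolding Omega_x_def[abs_def] diff_conv_add_uminus
    by (intro Ck_on_mat22 Ck_on_add D(1) neg Ck_cnj smooth)
  show "Ck_on n D R" unfolding Omega_y_def[abs_def]
    by (intro Ck_on_mat22 Ck_on_add D(1) m Ck_cnj smooth)
qed

lemma deriv_PR:
  assumes z: "z \<in> D"
  shows "dx P z = mat22 (cnj (dx \<upsilon> z) - dx \<upsilon> z) (dx q z - cnj (dx r z)) (dx r z - cnj (dx q z)) (dx \<upsilon> z - cnj (dx \<upsilon> z))"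
    and "dy P z = mat22 (cnj (dy \<upsilon> z) - dy \<upsilon> z) (dy q z - cnj (dy r z)) (dy r z - cnj (dy q z)) (dy \<upsilon> z - cnj (dy \<upsilon> z))"
    and "dx R z = mat22 (- \<i> * (dx \<upsilon> z + cnj (dx \<upsilon> z))) (\<i> * (dx q z + cnj (dx r z)))
      (\<i> * (dx r z + cnj (dx q z))) (\<i> * (dx \<upsilon> z + cnj (dx \<upsilon> z)))"
    and "dy R z = mat22 (- \<i> * (dy \<upsilon> z + cnj (dy \<upsilon> z))) (\<i> * (dy q z + cnj (dy r z)))
      (\<i> * (dy r z + cnj (dy q z))) (\<i> * (dy \<upsilon> z + cnj (dy \<upsilon> z)))"
proof -
  have d: "\<upsilon> differentiable (at z)" "q differentiable (at z)" "r differentiable (at z)"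
    using smooth[of 1] z by auto
  note e = d[THEN has_derivative_dx_dy]
  note c = bounded_linear.has_derivative[OF bounded_linear_cnj]
  have 1: "((\<lambda>z. h z - cnj (k z)) has_derivative (\<lambda>v. (Re v *\<^sub>R dx h z + Im v *\<^sub>R dy h z) - cnj (Re v *\<^sub>R dx k z + Im v *\<^sub>R dy k z))) (at z)"
    "((\<lambda>z. cnj (h z) - k z) has_derivative (\<lambda>v. cnj (Re v *\<^sub>R dx h z + Im v *\<^sub>R dy h z) - (Re v *\<^sub>R dx k z + Im v *\<^sub>R dy k z))) (at z)"
    "((\<lambda>z. a * (h z + cnj (k z))) has_derivative (\<lambda>v. a * ((Re v *\<^sub>R dx h z + Im v *\<^sub>R dy h z) + cnj (Re v *\<^sub>R dx k z + Im v *\<^sub>R dy k z)))) (at z)"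
    if "h differentiable (at z)" "k differentiable (at z)" for h k a
    by (intro has_derivative_diff has_derivative_add has_derivative_mult_right c
      that[THEN has_derivative_dx_dy])+
  have 2: "(\<lambda>z. h z - cnj (k z)) differentiable (at z)"
    "(\<lambda>z. cnj (h z) - k z) differentiable (at z)"
    "(\<lambda>z. a * (h z + cnj (k z))) differentiable (at z)"
    if "h differentiable (at z)" "k differentiable (at z)" for h k a
    using 1[OF that] by (auto simp: differentiable_def)
  show "dx P z = mat22 (cnj (dx \<upsilon> z) - dx \<upsilon> z) (dx q z - cnj (dx r z)) (dx r z - cnj (dx q z)) (dx \<upsilon> z - cnj (dx \<upsilon> z))"
    unfolding Omega_x_def[abs_def] by (subst dx_mat22; (intro 2 d)?) (simp add: 1[THEN dx_eqI] d)
  show "dy P z = mat22 (cnj (dy \<upsilon> z) - dy \<upsilon> z) (dy q z - cnj (dy r z)) (dy r z - cnj (dy q z)) (dy \<upsilon> z - cnj (dy \<upsilon> z))"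
    unfolding Omega_x_def[abs_def] by (subst dy_mat22; (intro 2 d)?) (simp add: 1[THEN dy_eqI] d)
  show "dx R z = mat22 (- \<i> * (dx \<upsilon> z + cnj (dx \<upsilon> z))) (\<i> * (dx q z + cnj (dx r z)))
      (\<i> * (dx r z + cnj (dx q z))) (\<i> * (dx \<upsilon> z + cnj (dx \<upsilon> z)))"
    unfolding Omega_y_def[abs_def] by (subst dx_mat22; (intro 2 d)?) (simp only: 1[THEN dx_eqI] d; simp)
  show "dy R z = mat22 (- \<i> * (dy \<upsilon> z + cnj (dy \<upsilon> z))) (\<i> * (dy q z + cnj (dy r z)))
      (\<i> * (dy r z + cnj (dy q z))) (\<i> * (dy \<upsilon> z + cnj (dy \<upsilon> z)))"
    unfolding Omega_y_def[abs_def] by (subst dy_mat22; (intro 2 d)?) (simp only: 1[THEN dy_eqI] d; simp)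
qed

text \<open>
  The equations in a form in which they can be substituted for $x$-derivatives, after which the
  matrix identities below hold entry by entry as polynomial identities.
\<close>

lemma dx_eqs:
  assumes z: "z \<in> D"
  shows "dx q z = - 4 * cnj (\<upsilon> z) * q z - \<i> * dy q z"
    and "dx r z = 4 * cnj (\<upsilon> z) * r z - \<i> * dy r z"
    and "dx \<upsilon> z = 2 * (q z * cnj (q z) - r z * cnj (r z)) - \<i> * dy \<upsilon> z - cnj (dx \<upsilon> z) + \<i> * cnj (dy \<upsilon> z)"
proof -
  show "dx q z = - 4 * cnj (\<upsilon> z) * q z - \<i> * dy q z"
    using q_zbar[OF z] by (simp add: d_zbar_def field_simps)
  show "dx r z = 4 * cnj (\<upsilon> z) * r z - \<i> * dy r z"
    using r_zbar[OF z] by (simp add: d_zbar_def field_simps)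
  show "dx \<upsilon> z = 2 * (q z * cnj (q z) - r z * cnj (r z)) - \<i> * dy \<upsilon> z - cnj (dx \<upsilon> z) + \<i> * cnj (dy \<upsilon> z)"
    using \<upsilon>_zbar[OF z] by (simp add: d_zbar_def field_simps) algebra
qed

lemma flat: "z \<in> D \<Longrightarrow> dy P z + R z ** P z = dx R z + P z ** R z"
  apply (simp only: deriv_PR Omega_x_def Omega_y_def mat22_ops mat22_eq_iff)
  apply (simp only: dx_eqs(1,2))
  apply (intro conjI)
  using arg_cong[OF dx_eqs(3), of z "\<lambda>x. \<i> * x"]
  apply (simp_all add: algebra_simps)
  done

text \<open>
  The left side is $F^*(M_{xx} + M_{yy})F$ for $M = F\sigma_3F^*$ and a unitary frame $F$. Its
  off-diagonal entries vanish by the equations for $q_{\bar z}$ and $r_{\bar z}$.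
\<close>

lemma laplace:
  defines "com X \<equiv> X ** sigma3 - sigma3 ** X"
  assumes z: "z \<in> D"
  shows "(P z ** com (P z) - com (P z) ** P z + com (dx P z)) +
    (R z ** com (R z) - com (R z) ** R z + com (dy R z)) =
    (- 8 * ((cmod (q z))\<^sup>2 + (cmod (r z))\<^sup>2)) *\<^sub>R sigma3"
  apply (simp only: com_def deriv_PR[OF z] Omega_x_def Omega_y_def sigma3_def mat22_ops mat22_eq_iff)
  apply (simp only: dx_eqs(1,2)[OF z])
  apply (intro conjI)
  apply (simp_all add: algebra_simps scaleR_conv_of_real cmod_square_cnj)
  done


text \<open>
  The covariant derivative on the sphere discards the component along the position vector, so
  the tension vanishes as soon as the Laplacian of the Gauss map is pointwise a multiple of it.
\<close>

theorem harmonic_frame: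
  obtains F where "F 0 = mat 1"
    "\<And>z. z \<in> D \<Longrightarrow> (F has_derivative (\<lambda>v. F z ** one_form P R z v)) (at z)"
    "\<And>z. z \<in> D \<Longrightarrow> F z \<in> SU2"
    "harmonic_into_sphere D (\<lambda>z. proj_S2 (F z))"
proof -
  have conn: "connected D" using D(2) simply_connected_imp_connected by blast
  obtain F where F0: "F 0 = mat 1"
    and F: "\<And>z. z \<in> D \<Longrightarrow> (F has_derivative (\<lambda>v. F z ** one_form P R z v)) (at z)"
    using flat_simply_connected[OF D Ck_on_PR flat] by blast
  have SU: "F z \<in> SU2" if "z \<in> D" for z
  proof -
    have "F z ** adj (F z) = mat 1"
      by (rule frames_agree(1)[OF D(1) conn D(3) F0 F0 F F one_form_skew(1) that])
    moreover have "det (F z) = 1"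
      by (rule det_frame[OF D(1) conn D(3) F0 F one_form_skew(2) that])
    ultimately show ?thesis by (simp add: SU2_def matrix_left_right_inverse)
  qed
  define com where "com X = X ** sigma3 - sigma3 ** X" for X
  define M where "M z = F z ** sigma3 ** adj (F z)" for z
  have bl_com: "bounded_linear com"
    unfolding com_def by (intro bounded_linear_sub matmul.bounded_linear_left matmul.bounded_linear_right)
  have conj: "((\<lambda>w. F w ** K w ** adj (F w)) has_derivative (\<lambda>v. F z **
      (one_form P R z v ** K z - K z ** one_form P R z v + (Re v *\<^sub>R dx K z + Im v *\<^sub>R dy K z)) ** adj (F z))) (at z)"
    if "z \<in> D" "K differentiable (at z)" for K z
    by (rule has_derivative_conjugation[OF F[OF that(1)] F[OF that(1)] has_derivative_dx_dy[OF that(2)]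
          one_form_skew(1)])
  have dcom: "dx (\<lambda>w. com (X w)) z = com (dx X z)" "dy (\<lambda>w. com (X w)) z = com (dy X z)"
    "(\<lambda>w. com (X w)) differentiable (at z)" if "X differentiable (at z)" for X z
    using bounded_linear.has_derivative[OF bl_com has_derivative_dx_dy[OF that]]
    by (auto dest: dx_eqI dy_eqI simp: differentiable_def)
  have dM: "dx M z = F z ** com (P z) ** adj (F z)" "dy M z = F z ** com (R z) ** adj (F z)"
    if "z \<in> D" for z
  proof -
    have "(M has_derivative (\<lambda>v. F z ** com (one_form P R z v) ** adj (F z))) (at z)"
      unfolding M_def com_def
      using has_derivative_conjugation[OF F[OF that] F[OF that] has_derivative_const one_form_skew(1), of sigma3]
      by simp
    from dx_eqI[OF this] dy_eqI[OF this]
    show "dx M z = F z ** com (P z) ** adj (F z)" "dy M z = F z ** com (R z) ** adj (F z)"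
      by (simp_all add: one_form_def)
  qed
  have dP: "P differentiable (at z)" and dR: "R differentiable (at z)" if "z \<in> D" for z
    using Ck_on_PR[of 1] that by auto
  have Laplace: "dx (dx M) z + dy (dy M) z = (- 8 * ((cmod (q z))\<^sup>2 + (cmod (r z))\<^sup>2)) *\<^sub>R M z"
    if z: "z \<in> D" for z
  proof -
    have "dx (dx M) z = F z ** (P z ** com (P z) - com (P z) ** P z + com (dx P z)) ** adj (F z)"
      using dx_cong[OF D(1) z dM(1)] dx_eqI[OF conj[OF z dcom(3)[OF dP[OF z]]]]
      by (simp add: one_form_def dcom(1)[OF dP[OF z]])
    moreover have "dy (dy M) z = F z ** (R z ** com (R z) - com (R z) ** R z + com (dy R z)) ** adj (F z)"
      using dy_cong[OF D(1) z dM(2)] dy_eqI[OF conj[OF z dcom(3)[OF dR[OF z]]]]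
      by (simp add: one_form_def dcom(2)[OF dR[OF z]])
    ultimately have "dx (dx M) z + dy (dy M) z =
      F z ** ((P z ** com (P z) - com (P z) ** P z + com (dx P z)) +
        (R z ** com (R z) - com (R z) ** R z + com (dy R z))) ** adj (F z)"
      by (simp only: matmul.add_left matmul.add_right)
    also have "\<dots> = (- 8 * ((cmod (q z))\<^sup>2 + (cmod (r z))\<^sup>2)) *\<^sub>R M z"
      unfolding com_def laplace[OF z] by (simp only: M_def matmul.scaleR_left matmul.scaleR_right)
    finally show ?thesis .
  qed
  have CF: "Ck_on n D F" for n by (rule Ck_on_frame[OF D(1) Ck_on_PR F])
  have CM: "Ck_on n D M" for n
    unfolding M_def
    by (intro Ck_on_bilinear[OF bounded_bilinear_matrix_mult D(1)] CF Ck_on_const[OF D(1)]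
        Ck_on_bounded_linear[OF bounded_linear_adj D(1)])
  define L :: "complex^2^2 \<Rightarrow> real^3" where "L X = vector [Re (X$2$1), Im (X$2$1), Re (X$1$1)]" for X
  have L: "bounded_linear L"
    unfolding linear_conv_bounded_linear[symmetric] linear_iff L_def by (simp add: vec_eq_iff forall_3)
  have proj: "proj_S2 (F z) = L (M z)" for z by (simp add: proj_S2_def L_def M_def Let_def)
  have dL: "dx (\<lambda>w. L (X w)) z = L (dx X z)" "dy (\<lambda>w. L (X w)) z = L (dy X z)"
    if "X differentiable (at z)" for X z
    using bounded_linear.has_derivative[OF L has_derivative_dx_dy[OF that]]
    by (auto dest: dx_eqI dy_eqI)
  have "harmonic_into_sphere D (\<lambda>z. L (M z))"
    unfolding harmonic_into_sphere_def smooth_on_def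
  proof (intro conjI allI ballI)
    show "Ck_on n D (\<lambda>z. L (M z))" for n by (rule Ck_on_bounded_linear[OF L D(1) CM])
    show "(\<lambda>z. L (M z)) ` D \<subseteq> sphere 0 1"
      using proj_S2_sphere[OF SU] by (auto simp: proj[symmetric])
    fix z assume z: "z \<in> D"
    have dM': "M differentiable (at w)" "dx M differentiable (at w)" "dy M differentiable (at w)"
      if "w \<in> D" for w using CM[of 2] that by (auto simp: numeral_2_eq_2)
    have "dx (dx (\<lambda>w. L (M w))) z = L (dx (dx M) z)"
      using dx_cong[OF D(1) z dL(1)[OF dM'(1)]] dL(1)[OF dM'(2)[OF z]] by simp
    moreover have "dy (dy (\<lambda>w. L (M w))) z = L (dy (dy M) z)"
      using dy_cong[OF D(1) z dL(2)[OF dM'(1)]] dL(2)[OF dM'(3)[OF z]] by simp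
    ultimately have "tension (\<lambda>z. L (M z)) z = tangential (L (M z)) (L (dx (dx M) z + dy (dy M) z))"
      by (simp add: tension_def tangential_def linear_add[OF bounded_linear.linear[OF L]] algebra_simps)
    also have "\<dots> = tangential (L (M z)) ((- 8 * ((cmod (q z))\<^sup>2 + (cmod (r z))\<^sup>2)) *\<^sub>R L (M z))"
      unfolding Laplace[OF z] linear_scale[OF bounded_linear.linear[OF L]] ..
    also have "\<dots> = 0"
      using proj_S2_sphere[OF SU[OF z]]
      by (simp add: tangential_def proj norm_eq_1)
    finally show "tension (\<lambda>z. L (M z)) z = 0" .
  qed
  with F0 F SU show ?thesis by (intro that[of F]) (simp_all add: proj)
qed

end

section \<open>The operators $\partial_z$ and $\partial_{\bar z}$\<close>

lemma
  assumes "h differentiable (at z)" "k differentiable (at z)"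
  shows d_z_add: "d_z (\<lambda>w. h w + k w) z = d_z h z + d_z k z"
    and d_zbar_add: "d_zbar (\<lambda>w. h w + k w) z = d_zbar h z + d_zbar k z"
    and d_z_mult: "d_z (\<lambda>w. h w * k w) z = d_z h z * k z + h z * d_z k z"
    and d_zbar_mult: "d_zbar (\<lambda>w. h w * k w) z = d_zbar h z * k z + h z * d_zbar k z"
proof -
  have "((\<lambda>w. h w + k w) has_derivative (\<lambda>v. (Re v *\<^sub>R dx h z + Im v *\<^sub>R dy h z) +
      (Re v *\<^sub>R dx k z + Im v *\<^sub>R dy k z))) (at z)"
    by (intro has_derivative_add has_derivative_dx_dy assms)
  from dx_eqI[OF this] dy_eqI[OF this]
  show "d_z (\<lambda>w. h w + k w) z = d_z h z + d_z k z" "d_zbar (\<lambda>w. h w + k w) z = d_zbar h z + d_zbar k z"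
    by (simp_all add: d_z_def d_zbar_def field_simps)
  show "d_z (\<lambda>w. h w * k w) z = d_z h z * k z + h z * d_z k z"
    "d_zbar (\<lambda>w. h w * k w) z = d_zbar h z * k z + h z * d_zbar k z"
    by (simp_all add: d_z_def d_zbar_def field_simps dx_bilinear[OF bounded_bilinear_mult assms]
        dy_bilinear[OF bounded_bilinear_mult assms])
qed

lemma d_z_const: "d_z (\<lambda>w. c) z = 0" and d_zbar_const: "d_zbar (\<lambda>w. c) z = 0"
  by (simp_all add: d_z_def d_zbar_def dx_eqI[OF has_derivative_const] dy_eqI[OF has_derivative_const])

lemma
  assumes "h differentiable (at z)"
  shows d_z_cmult: "d_z (\<lambda>w. c * h w) z = c * d_z h z"
    and d_zbar_cmult: "d_zbar (\<lambda>w. c * h w) z = c * d_zbar h z"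
  using d_z_mult[OF differentiable_const assms] d_zbar_mult[OF differentiable_const assms]
  by (simp_all add: d_z_const d_zbar_const)

lemma
  assumes "h differentiable (at z)"
  shows d_zbar_cnj: "d_zbar (\<lambda>w. cnj (h w)) z = cnj (d_z h z)"
  using dx_eqI[OF bounded_linear.has_derivative[OF bounded_linear_cnj has_derivative_dx_dy[OF assms]]]
    dy_eqI[OF bounded_linear.has_derivative[OF bounded_linear_cnj has_derivative_dx_dy[OF assms]]]
  by (simp_all add: d_z_def d_zbar_def)

lemma
  fixes h :: "complex \<Rightarrow> real"
  assumes "h differentiable (at z)" "(\<phi> has_field_derivative \<phi>') (at (h z))"
  shows d_z_chain_real: "d_z (\<lambda>w. complex_of_real (\<phi> (h w))) z = of_real \<phi>' * d_z (\<lambda>w. of_real (h w)) z"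
    and d_zbar_chain_real: "d_zbar (\<lambda>w. complex_of_real (\<phi> (h w))) z = of_real \<phi>' * d_zbar (\<lambda>w. of_real (h w)) z"
proof -
  have r: "dx (\<lambda>w. complex_of_real (k w)) z = of_real (dx k z)" "dy (\<lambda>w. complex_of_real (k w)) z = of_real (dy k z)"
    if "k differentiable (at z)" for k :: "complex \<Rightarrow> real"
    using dx_eqI[OF bounded_linear.has_derivative[OF bounded_linear_of_real has_derivative_dx_dy[OF that]]]
      dy_eqI[OF bounded_linear.has_derivative[OF bounded_linear_of_real has_derivative_dx_dy[OF that]]]
    by simp_all
  show "d_z (\<lambda>w. complex_of_real (\<phi> (h w))) z = of_real \<phi>' * d_z (\<lambda>w. of_real (h w)) z"
    "d_zbar (\<lambda>w. complex_of_real (\<phi> (h w))) z = of_real \<phi>' * d_zbar (\<lambda>w. of_real (h w)) z"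
    unfolding d_z_def d_zbar_def r[OF assms(1)] r[OF differentiable_chain_real[OF assms]]
      dx_chain_real[OF assms] dy_chain_real[OF assms]
    by (simp_all add: algebra_simps)
qed

lemma
  assumes "open D" "z \<in> D" "\<And>w. w \<in> D \<Longrightarrow> h w = k w"
  shows d_z_cong: "d_z h z = d_z k z" and d_zbar_cong: "d_zbar h z = d_zbar k z"
  unfolding d_z_def d_zbar_def using dx_cong[OF assms] dy_cong[OF assms] by simp_all

lemma
  assumes "open D" "Ck_on (Suc n) D h"
  shows Ck_on_d_z: "Ck_on n D (d_z h)" and Ck_on_d_zbar: "Ck_on n D (d_zbar h)"
proof -
  have e: "d_z h = (\<lambda>z. (1/2) * (dx h z + (- \<i>) * dy h z))" "d_zbar h = (\<lambda>z. (1/2) * (dx h z + \<i> * dy h z))"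
    by (auto simp: d_z_def d_zbar_def)
  show "Ck_on n D (d_z h)" "Ck_on n D (d_zbar h)"
    unfolding e using assms(2)
    by (intro Ck_on_bounded_linear[OF bounded_linear_mult_right assms(1)] Ck_on_add[OF assms(1)]; simp)+
qed

lemma d_z_d_zbar_commute:
  assumes "open D" "Ck_on 2 D h" "z \<in> D"
  shows "d_z (d_zbar h) z = d_zbar (d_z h) z"
proof -
  have d: "dx h differentiable (at z)" "dy h differentiable (at z)"
    using assms(2,3) by (auto simp: numeral_2_eq_2)
  have e: "((\<lambda>z. (dx h z + c * dy h z) / 2) has_derivative (\<lambda>v. ((Re v *\<^sub>R dx (dx h) z + Im v *\<^sub>R dy (dx h) z)
      + c * (Re v *\<^sub>R dx (dy h) z + Im v *\<^sub>R dy (dy h) z)) / 2)) (at z)" for c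
    by (intro bounded_linear.has_derivative[OF bounded_linear_divide] has_derivative_add has_derivative_mult_right has_derivative_dx_dy d)
  have zb: "d_zbar h = (\<lambda>z. (dx h z + \<i> * dy h z) / 2)" and z: "d_z h = (\<lambda>z. (dx h z + (- \<i>) * dy h z) / 2)"
    by (auto simp: d_z_def d_zbar_def)
  show ?thesis
    unfolding zb z d_z_def[of "\<lambda>z. (dx h z + \<i> * dy h z) / 2"]
      d_zbar_def[of "\<lambda>z. (dx h z + (- \<i>) * dy h z) / 2"] dx_eqI[OF e] dy_eqI[OF e]
    by (simp add: mixed_partials_commute[OF assms] field_simps)
qed

section \<open>The Gauss and Codazzi equations in hyperbolic space\<close>

lemma four_eq_zero: "(4::4) = 0" by simp

lemma mink_sum: "mink x y = (\<Sum>k\<in>UNIV. (if k = 0 then -1 else 1) * (x $ k * y $ k))"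
  by (simp add: mink_def sum_4 four_eq_zero)

lemma mink_commute: "mink x y = mink y x"
  by (simp add: mink_def mult.commute)

lemma mink_scale: "mink v (c *s w) = c * mink v w" for c :: "'a::comm_ring_1"
  by (simp add: mink_def algebra_simps)

lemma mink_minus: "mink v (- w) = - mink v w"
  by (simp add: mink_def)

text \<open>
  The Parseval identity for the basis $x, n, p, q$: its dual basis for the Minkowski form is
  $-x, n, \frac2E q, \frac2E p$. Stated for matrices, a right inverse of a square matrix is a left
  inverse.
\<close>

lemma mink_frame_expansion:
  fixes x n p q v w :: "complex^4"
  assumes "E \<noteq> 0" "mink x x = -1" "mink n n = 1" "mink p p = 0" "mink q q = 0" "mink p q = E / 2"
    "mink x n = 0" "mink p x = 0" "mink q x = 0" "mink p n = 0" "mink q n = 0"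
  shows "mink v w = - (mink v x * mink w x) + mink v n * mink w n +
    2 / E * (mink v p * mink w q + mink v q * mink w p)"
proof -
  define e :: "4 \<Rightarrow> complex" where "e k = (if k = 0 then -1 else 1)" for k
  have mink: "mink a b = (\<Sum>k\<in>UNIV. e k * (a $ k * b $ k))" for a b by (simp add: mink_sum e_def)
  define b :: "4 \<Rightarrow> complex^4" where "b i = (if i = 1 then x else if i = 2 then n else if i = 3 then p else q)" for i
  \<comment> \<open>the dual basis\<close>
  define b' :: "4 \<Rightarrow> complex^4" where
    "b' i = (if i = 1 then (- 1) *s x else if i = 2 then n
      else if i = 3 then (2 / E) *s q else (2 / E) *s p)" for i
  define A :: "complex^4^4" where "A = (\<chi> i k. b i $ k)"
  define C :: "complex^4^4" where "C = (\<chi> k j. e k * b' j $ k)"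
  have sym: "mink q p = E / 2" "mink n x = 0" "mink x p = 0" "mink x q = 0" "mink n p = 0" "mink n q = 0"
    using assms mink_commute by metis+
  have "\<forall>i j. mink (b i) (b' j) = (if i = j then 1 else 0)"
    unfolding forall_4 b_def b'_def by (simp add: mink_scale mink_minus assms sym)
  then have "A ** C = mat 1"
    by (simp add: vec_eq_iff matrix_matrix_mult_def mat_def A_def C_def mink mult_ac)
  then have CA: "C ** A = mat 1" using matrix_left_right_inverse by blast
  have CA': "(\<Sum>j\<in>UNIV. (e k * b' j $ k) * b j $ l) = (if k = l then 1 else 0)" for k l
    using arg_cong[OF CA, of "\<lambda>X. X $ k $ l"] by (simp add: matrix_matrix_mult_def mat_def A_def C_def)
  have "mink v w = (\<Sum>k\<in>UNIV. \<Sum>l\<in>UNIV. v $ k * (e l * w $ l) * (if k = l then 1 else 0))"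
    by (simp add: mink sum.delta' mult_ac if_distrib cong: if_cong)
  also have "\<dots> = (\<Sum>k\<in>UNIV. \<Sum>l\<in>UNIV. \<Sum>j\<in>UNIV. (e k * (v $ k * b' j $ k)) * (e l * (w $ l * b j $ l)))"
    unfolding CA'[symmetric] by (simp add: sum_distrib_left mult_ac)
  also have "\<dots> = (\<Sum>k\<in>UNIV. \<Sum>j\<in>UNIV. \<Sum>l\<in>UNIV. (e k * (v $ k * b' j $ k)) * (e l * (w $ l * b j $ l)))"
    by (rule sum.cong[OF refl], rule sum.swap)
  also have "\<dots> = (\<Sum>j\<in>UNIV. mink v (b' j) * mink w (b j))"
    unfolding mink sum_product by (rule sum.swap)
  also have "\<dots> = - (mink v x * mink w x) + mink v n * mink w n +
    2 / E * (mink v p * mink w q + mink v q * mink w p)"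
    by (simp add: sum_4 b_def b'_def mink_scale mink_minus algebra_simps)
  finally show ?thesis .
qed


lemma
  fixes a b :: "complex \<Rightarrow> complex^4"
  assumes "\<And>k. (\<lambda>w. a w $ k) differentiable (at z)" "\<And>k. (\<lambda>w. b w $ k) differentiable (at z)"
  shows d_z_mink: "d_z (\<lambda>w. mink (a w) (b w)) z = mink (vd_z a z) (b z) + mink (a z) (vd_z b z)"
    and d_zbar_mink: "d_zbar (\<lambda>w. mink (a w) (b w)) z = mink (vd_zbar a z) (b z) + mink (a z) (vd_zbar b z)"
proof -
  have e: "(\<lambda>w. mink (a w) (b w)) = (\<lambda>w. (- 1) * (a w $ 0 * b w $ 0) + a w $ 1 * b w $ 1
      + a w $ 2 * b w $ 2 + a w $ 3 * b w $ 3)" by (simp add: mink_def)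
  note m = differentiable_bilinear[OF bounded_bilinear_mult assms] 
  have m0: "(\<lambda>w. (- 1) * (a w $ 0 * b w $ 0)) differentiable (at z)"
    by (rule differentiable_bilinear[OF bounded_bilinear_mult differentiable_const m])
  note ad = differentiable_add
  show "d_z (\<lambda>w. mink (a w) (b w)) z = mink (vd_z a z) (b z) + mink (a z) (vd_z b z)"
    unfolding e
    by (simp only: d_z_add[OF ad[OF ad[OF m0 m] m] m] d_z_add[OF ad[OF m0 m] m] d_z_add[OF m0 m]
        d_z_cmult[OF m] d_z_mult[OF assms])
      (simp add: mink_def vd_z_def algebra_simps)
  show "d_zbar (\<lambda>w. mink (a w) (b w)) z = mink (vd_zbar a z) (b z) + mink (a z) (vd_zbar b z)"
    unfolding e
    by (simp only: d_zbar_add[OF ad[OF ad[OF m0 m] m] m] d_zbar_add[OF ad[OF m0 m] m] d_zbar_add[OF m0 m]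
        d_zbar_cmult[OF m] d_zbar_mult[OF assms])
      (simp add: mink_def vd_zbar_def algebra_simps)
qed

locale cmc_surface =
  fixes D :: "complex set"
    and f N :: "complex \<Rightarrow> real^4"
    and u :: "complex \<Rightarrow> real"
    and Q :: "complex \<Rightarrow> complex"
    and H :: real
  assumes D: "open D"
    and immersion: "conformal_immersion D f u"
    and normal: "unit_normal D f N"
    and hopf: "\<And>z. z \<in> D \<Longrightarrow> Q z = hopf_coeff f N z"
    and cmc: "\<And>z. z \<in> D \<Longrightarrow> has_mean_curvature f N u H z"
begin

definition "fc w = cvec (f w)"
definition "Nc w = cvec (N w)"
abbreviation "p \<equiv> vd_z fc"
abbreviation "q \<equiv> vd_zbar fc"
definition "E w = complex_of_real (exp (2 * u w))"
definition "csmooth V \<longleftrightarrow> (\<forall>k n. Ck_on n D (\<lambda>w. V w $ k))" for V :: "complex \<Rightarrow> complex^4"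

lemma csmooth_fc: "csmooth fc" and csmooth_Nc: "csmooth Nc"
proof -
  have "smooth_on D f" "smooth_on D N"
    using immersion normal by (auto simp: conformal_immersion_def unit_normal_def)
  then have "Ck_on n D (\<lambda>w. complex_of_real (f w $ k))" "Ck_on n D (\<lambda>w. complex_of_real (N w $ k))" for n k
    unfolding smooth_on_def
    by (intro Ck_on_bounded_linear[OF bounded_linear_of_real D] Ck_on_bounded_linear[OF bounded_linear_vec_nth D]; blast)+
  then show "csmooth fc" "csmooth Nc"
    unfolding csmooth_def fc_def[abs_def] Nc_def[abs_def] cvec_def by simp_all
qed

lemma csmooth_vd: assumes "csmooth V" shows "csmooth (vd_z V)" "csmooth (vd_zbar V)"
proof -
  have e: "(\<lambda>w. vd_z V w $ k) = d_z (\<lambda>w. V w $ k)" "(\<lambda>w. vd_zbar V w $ k) = d_zbar (\<lambda>w. V w $ k)" for k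
    by (simp_all add: vd_z_def vd_zbar_def)
  show "csmooth (vd_z V)" "csmooth (vd_zbar V)"
    using assms unfolding csmooth_def e by (blast intro: Ck_on_d_z[OF D] Ck_on_d_zbar[OF D])+
qed

lemmas csm = csmooth_fc csmooth_Nc csmooth_vd

lemma csmooth_differentiable: "csmooth V \<Longrightarrow> z \<in> D \<Longrightarrow> (\<lambda>w. V w $ k) differentiable (at z)"
  unfolding csmooth_def by (metis Ck_on.simps(2))

lemma Ck_on_mink: "csmooth a \<Longrightarrow> csmooth b \<Longrightarrow> Ck_on n D (\<lambda>w. mink (a w) (b w))"
  unfolding mink_def csmooth_def
  by (intro Ck_on_add[OF D] Ck_on_bounded_linear[OF bounded_linear_minus[OF bounded_linear_ident] D]
      Ck_on_bilinear[OF bounded_bilinear_mult D]) auto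

lemma vd_z_vd_zbar_commute: "csmooth V \<Longrightarrow> z \<in> D \<Longrightarrow> vd_z (vd_zbar V) z = vd_zbar (vd_z V) z"
  unfolding csmooth_def
  by (simp add: vec_eq_iff vd_z_def[of "vd_zbar V"] vd_zbar_def[of "vd_z V"])
    (simp add: vd_z_def vd_zbar_def d_z_d_zbar_commute[OF D])

text \<open>
  A relation between inner products that holds on the whole domain may be differentiated.
\<close>

lemma
  assumes "csmooth a" "csmooth b" "\<And>w. w \<in> D \<Longrightarrow> mink (a w) (b w) = \<phi> w" "z \<in> D"
  shows d_z_relation: "mink (vd_z a z) (b z) + mink (a z) (vd_z b z) = d_z \<phi> z"
    and d_zbar_relation: "mink (vd_zbar a z) (b z) + mink (a z) (vd_zbar b z) = d_zbar \<phi> z"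
  using d_z_mink[OF csmooth_differentiable[OF assms(1,4)] csmooth_differentiable[OF assms(2,4)]]
    d_zbar_mink[OF csmooth_differentiable[OF assms(1,4)] csmooth_differentiable[OF assms(2,4)]]
    d_z_cong[OF D assms(4,3)] d_zbar_cong[OF D assms(4,3)] by simp_all

lemma real_fields: "fc w $ k = of_real (f w $ k)" "Nc w $ k = of_real (N w $ k)"
  by (simp_all add: fc_def Nc_def cvec_def)

lemma differentiable_f: "z \<in> D \<Longrightarrow> f differentiable (at z)"
  using immersion Ck_on.simps(2) unfolding conformal_immersion_def smooth_on_def by metis

lemma first_derivatives:
  assumes "z \<in> D"
  shows "p z $ k = (of_real (dx f z $ k) - \<i> * of_real (dy f z $ k)) / 2"
    and "q z $ k = (of_real (dx f z $ k) + \<i> * of_real (dy f z $ k)) / 2"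
proof -
  have "((\<lambda>w. complex_of_real (f w $ k)) has_derivative
      (\<lambda>v. of_real ((Re v *\<^sub>R dx f z + Im v *\<^sub>R dy f z) $ k))) (at z)"
    by (intro bounded_linear.has_derivative[OF bounded_linear_of_real]
        bounded_linear.has_derivative[OF bounded_linear_vec_nth]
        has_derivative_dx_dy differentiable_f assms)
  from dx_eqI[OF this] dy_eqI[OF this]
  show "p z $ k = (of_real (dx f z $ k) - \<i> * of_real (dy f z $ k)) / 2"
    "q z $ k = (of_real (dx f z $ k) + \<i> * of_real (dy f z $ k)) / 2"
    by (simp_all add: vd_z_def vd_zbar_def real_fields d_z_def d_zbar_def)
qed

lemma gram:
  assumes z: "z \<in> D"
  shows "mink (p z) (p z) = 0" "mink (p z) (q z) = E z / 2" "mink (q z) (q z) = 0"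
    "mink (fc z) (fc z) = - 1" "mink (Nc z) (Nc z) = 1" "mink (fc z) (Nc z) = 0"
    "mink (p z) (Nc z) = 0" "mink (q z) (Nc z) = 0"
proof -
  show pp: "mink (p z) (p z) = 0" and "mink (p z) (q z) = E z / 2"
    using immersion z by (simp_all add: conformal_immersion_def Let_def fc_def[abs_def] E_def)
  have "mink (q z) (q z) = cnj (mink (p z) (p z))"
    by (simp add: mink_def first_derivatives[OF z])
  then show "mink (q z) (q z) = 0" by (simp add: pp)
  have "mink (f z) (f z) = - 1" using immersion z by (auto simp: conformal_immersion_def H3_def)
  then have "complex_of_real (mink (f z) (f z)) = - 1" by simp
  then show "mink (fc z) (fc z) = - 1" by (simp add: mink_def real_fields)
  have n: "mink (N z) (N z) = 1" "mink (N z) (f z) = 0" "mink (N z) (dx f z) = 0" "mink (N z) (dy f z) = 0"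
    using normal z by (auto simp: unit_normal_def)
  then have n': "complex_of_real (mink (N z) (N z)) = 1" "complex_of_real (mink (N z) (f z)) = 0"
    "complex_of_real (mink (N z) (dx f z)) = 0" "complex_of_real (mink (N z) (dy f z)) = 0" by simp_all
  show "mink (Nc z) (Nc z) = 1" using n'(1) by (simp add: mink_def real_fields)
  show "mink (fc z) (Nc z) = 0" using n'(2) by (simp add: mink_def real_fields mult.commute)
  have "mink (p z) (Nc z) = (of_real (mink (N z) (dx f z)) - \<i> * of_real (mink (N z) (dy f z))) / 2"
    "mink (q z) (Nc z) = (of_real (mink (N z) (dx f z)) + \<i> * of_real (mink (N z) (dy f z))) / 2"
    by (simp_all add: mink_def first_derivatives[OF z] real_fields field_simps)
  then show "mink (p z) (Nc z) = 0" "mink (q z) (Nc z) = 0" using n by simp_all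
qed

text \<open>
  The conformal factor is smooth because $e^{2u} = 2\langle f_z, f_{\bar z}\rangle$.
\<close>

lemma smooth_u: "Ck_on n D u"
proof -
  have "Ck_on n D (\<lambda>w. Re (2 * mink (p w) (q w)))"
    by (intro Ck_on_bounded_linear[OF bounded_linear_Re D] Ck_on_bounded_linear[OF bounded_linear_mult_right D]
        Ck_on_mink csm)
  moreover have e: "2 * Re (mink (p w) (q w)) = exp (2 * u w)" if "w \<in> D" for w
    by (simp add: gram(2)[OF that] E_def)
  ultimately have "Ck_on n D (\<lambda>w. (1/2) * ln (Re (2 * mink (p w) (q w))))"
    by (intro Ck_on_bounded_linear[OF bounded_linear_mult_right D] Ck_on_ln[OF D]) simp_all
  then show ?thesis
    by (rule Ck_on_cong[OF D, THEN iffD1, rotated]) (simp add: e)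
qed

lemma differentiable_u: "z \<in> D \<Longrightarrow> u differentiable (at z)"
  using smooth_u[of 1] by simp

definition "uc w = complex_of_real (u w)"

lemma Ck_on_uc: "Ck_on n D uc"
  unfolding uc_def[abs_def] by (rule Ck_on_bounded_linear[OF bounded_linear_of_real D smooth_u])

lemma Q_eq: "z \<in> D \<Longrightarrow> mink (vd_z p z) (Nc z) = Q z"
  using hopf by (simp add: hopf_coeff_def fc_def[abs_def] Nc_def)

lemma H_eq: "z \<in> D \<Longrightarrow> mink (vd_zbar p z) (Nc z) = of_real H * E z / 2"
  using cmc by (simp add: has_mean_curvature_def fc_def[abs_def] Nc_def E_def)

lemma smooth_Q: "Ck_on n D Q"
  using Ck_on_mink[OF csm(3)[OF csm(3)[OF csm(1)]] csm(2)]
  by (rule Ck_on_cong[OF D, THEN iffD1, rotated]) (simp add: Q_eq)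

lemma Ck_on_E: "Ck_on n D E"
  unfolding E_def[abs_def]
  by (intro Ck_on_bounded_linear[OF bounded_linear_of_real D] Ck_on_exp[OF D]
      Ck_on_bounded_linear[OF bounded_linear_mult_right D] smooth_u)

lemma differentiable_E: "z \<in> D \<Longrightarrow> E differentiable (at z)"
  using Ck_on_E[of 1] by simp

lemma d_E:
  assumes z: "z \<in> D"
  shows "d_z E z = 2 * E z * d_z uc z" "d_zbar E z = 2 * E z * d_zbar uc z"
proof -
  have "((\<lambda>x. exp (2 * x)) has_field_derivative 2 * exp (2 * u z)) (at (u z))"
    by (auto intro!: derivative_eq_intros)
  note * = d_z_chain_real[OF differentiable_u[OF z] this] d_zbar_chain_real[OF differentiable_u[OF z] this]
  show "d_z E z = 2 * E z * d_z uc z" "d_zbar E z = 2 * E z * d_zbar uc z"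
    using * by (simp_all add: E_def[abs_def] uc_def[abs_def])
qed

lemma csm': "csmooth p" "csmooth q" "csmooth (vd_z p)" "csmooth (vd_zbar p)" "csmooth (vd_zbar q)"
  by (intro csm)+

lemma position_tangent:
  assumes z: "z \<in> D"
  shows "mink (p z) (fc z) = 0" "mink (q z) (fc z) = 0"
  using d_z_relation[OF csm(1) csm(1) gram(4) z] d_zbar_relation[OF csm(1) csm(1) gram(4) z]
  by (simp_all add: d_z_const d_zbar_const mink_commute[of "fc z"])

text \<open>
  The products of $f_{zz}, f_{z\bar z}, f_{\bar z\bar z}$ with $f, f_z, f_{\bar z}$ are obtained by
  differentiating the Gram relations; the last one holds because $f$ and $N$ are real.
\<close>

lemma second_derivatives:
  assumes z: "z \<in> D"
  shows "mink (vd_zbar p z) (p z) = 0" "mink (vd_zbar p z) (q z) = 0"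
    and "mink (vd_z p z) (p z) = 0" "mink (vd_z p z) (q z) = d_z E z / 2"
    and "mink (vd_zbar q z) (q z) = 0" "mink (vd_zbar q z) (p z) = d_zbar E z / 2"
    and "mink (vd_zbar p z) (fc z) = - E z / 2" "mink (vd_z p z) (fc z) = 0" "mink (vd_zbar q z) (fc z) = 0"
    and "mink (vd_zbar q z) (Nc z) = cnj (Q z)"
proof -
  have qz: "vd_z q z = vd_zbar p z" by (rule vd_z_vd_zbar_commute[OF csm(1) z])
  have dE2: "d_z (\<lambda>w. E w / 2) z = d_z E z / 2" "d_zbar (\<lambda>w. E w / 2) z = d_zbar E z / 2"
    using d_z_cmult[OF differentiable_E[OF z], of "1/2"] d_zbar_cmult[OF differentiable_E[OF z], of "1/2"] by simp_all
  show 1: "mink (vd_zbar p z) (p z) = 0"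
    using d_zbar_relation[OF csm'(1,1) gram(1) z] by (simp add: d_zbar_const mink_commute[of "p z"])
  show 2: "mink (vd_zbar p z) (q z) = 0"
    using d_z_relation[OF csm'(2,2) gram(3) z] by (simp add: d_z_const qz mink_commute[of "q z"])
  show "mink (vd_z p z) (p z) = 0"
    using d_z_relation[OF csm'(1,1) gram(1) z] by (simp add: d_z_const mink_commute[of "p z"])
  show "mink (vd_zbar q z) (q z) = 0"
    using d_zbar_relation[OF csm'(2,2) gram(3) z] by (simp add: d_zbar_const mink_commute[of "q z"])
  show "mink (vd_z p z) (q z) = d_z E z / 2"
    using d_z_relation[OF csm'(1,2) gram(2) z] by (simp add: dE2 qz mink_commute[of "p z"] 1)
  show "mink (vd_zbar q z) (p z) = d_zbar E z / 2"
    using d_zbar_relation[OF csm'(1,2) gram(2) z] by (simp add: dE2 mink_commute[of "p z"] 2)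
  show "mink (vd_zbar p z) (fc z) = - E z / 2"
    using d_zbar_relation[OF csm'(1) csm(1) position_tangent(1) z]
    by (simp add: d_zbar_const gram[OF z] add_eq_0_iff)
  show "mink (vd_z p z) (fc z) = 0"
    using d_z_relation[OF csm'(1) csm(1) position_tangent(1) z] by (simp add: d_z_const gram[OF z])
  show "mink (vd_zbar q z) (fc z) = 0"
    using d_zbar_relation[OF csm'(2) csm(1) position_tangent(2) z] by (simp add: d_zbar_const gram[OF z])
  have qp: "q w $ k = cnj (p w $ k)" if "w \<in> D" for w k by (simp add: first_derivatives[OF that])
  have "vd_zbar q z $ k = cnj (vd_z p z $ k)" for k
  proof -
    have "vd_zbar q z $ k = d_zbar (\<lambda>w. cnj (p w $ k)) z"
      by (subst vd_zbar_def) (simp add: d_zbar_cong[OF D z qp])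
    then show ?thesis
      by (simp add: d_zbar_cnj[OF csmooth_differentiable[OF csm'(1) z]] vd_z_def[of p])
  qed
  then have "mink (vd_zbar q z) (Nc z) = cnj (mink (vd_z p z) (Nc z))"
    by (simp add: mink_def real_fields)
  then show "mink (vd_zbar q z) (Nc z) = cnj (Q z)" by (simp add: Q_eq[OF z])
qed

lemma normal_derivatives:
  assumes z: "z \<in> D"
  shows "mink (vd_z Nc z) (Nc z) = 0" "mink (vd_zbar Nc z) (Nc z) = 0"
    and "mink (vd_zbar Nc z) (fc z) = 0"
    and "mink (vd_zbar Nc z) (p z) = - of_real H * E z / 2" "mink (vd_zbar Nc z) (q z) = - cnj (Q z)"
    and "mink (vd_z Nc z) (fc z) = 0"
  using d_z_relation[OF csm(2) csm(2) gram(5) z] d_zbar_relation[OF csm(2) csm(2) gram(5) z]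
    d_z_relation[OF csm(1,2) gram(6) z] d_zbar_relation[OF csm(1,2) gram(6) z]
    d_zbar_relation[OF csm'(1) csm(2) gram(7) z] d_zbar_relation[OF csm'(2) csm(2) gram(8) z]
  by (simp_all add: d_z_const d_zbar_const mink_commute[of "Nc z"] mink_commute[of "fc z"]
      mink_commute[of "p z" "vd_zbar Nc z"] mink_commute[of "q z" "vd_zbar Nc z"]
      gram[OF z] H_eq[OF z] second_derivatives[OF z] add_eq_0_iff)

lemma frame_expansion:
  assumes z: "z \<in> D"
  shows "mink v w = - (mink v (fc z) * mink w (fc z)) + mink v (Nc z) * mink w (Nc z) +
    2 / E z * (mink v (p z) * mink w (q z) + mink v (q z) * mink w (p z))"
  by (rule mink_frame_expansion) (simp_all add: gram[OF z] position_tangent[OF z] E_def)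

text \<open>
  Differentiate $Q = \langle f_{zz}, N\rangle$ by $\bar z$ and
  $\frac12 HE = \langle f_{z\bar z}, N\rangle$ by $z$, and compare the third derivatives of $f$. The
  remaining products with derivatives of $N$ are evaluated by the expansion in the basis; the
  constancy of $H$ makes them cancel.
\<close>

lemma codazzi:
  assumes z: "z \<in> D"
  shows "d_zbar Q z = 0"
proof -
  have E0: "E z \<noteq> 0" by (simp add: E_def)
  have Q': "mink (vd_zbar (vd_z p) z) (Nc z) + mink (vd_z p z) (vd_zbar Nc z) = d_zbar Q z"
    by (rule d_zbar_relation[OF csm'(3) csm(2) Q_eq z])
  have "mink (vd_zbar p z) (vd_z Nc z) = 0"
    by (subst frame_expansion[OF z]) (simp add: second_derivatives[OF z] normal_derivatives[OF z])
  then have 1: "mink (vd_zbar (vd_z p) z) (Nc z) = of_real H * d_z E z / 2"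
    using d_z_relation[OF csm'(4) csm(2) H_eq z] d_z_cmult[OF differentiable_E[OF z], of "of_real H / 2"]
      vd_z_vd_zbar_commute[OF csm'(1) z] by simp
  have 2: "mink (vd_z p z) (vd_zbar Nc z) = - (of_real H * d_z E z / 2)"
    using E0 by (subst frame_expansion[OF z])
      (simp add: second_derivatives[OF z] normal_derivatives[OF z])
  show ?thesis using Q' unfolding 1 2 by simp
qed

text \<open>
  The same comparison of third derivatives, now from $\langle f_{zz}, f_{\bar z}\rangle = \frac12E_z$
  and $\langle f_{z\bar z}, f_{\bar z}\rangle = 0$; inserting $E = e^{2u}$ turns it into an
  equation for $u$.
\<close>

lemma gauss:
  assumes z: "z \<in> D"
  shows "d_zbar (d_z uc) z = E z / 4 * (1 - (of_real H)\<^sup>2) + Q z * cnj (Q z) / E z"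
proof -
  have E0: "E z \<noteq> 0" by (simp add: E_def)
  have "d_z uc differentiable (at z)" using Ck_on_d_z[OF D Ck_on_uc, of 1] z by simp
  then have "d_zbar (\<lambda>w. 2 * E w * d_z uc w) z =
      2 * d_zbar E z * d_z uc z + 2 * E z * d_zbar (d_z uc) z"
    using differentiable_E[OF z]
    by (simp add: mult.assoc d_zbar_cmult d_zbar_mult differentiable_mult algebra_simps)
  then have ddE: "d_zbar (d_z E) z = 4 * E z * d_z uc z * d_zbar uc z + 2 * E z * d_zbar (d_z uc) z"
    using d_zbar_cong[OF D z d_E(1)] by (simp add: d_E[OF z])
  have "d_z E differentiable (at z)" using Ck_on_d_z[OF D Ck_on_E, of 1] z by simp
  then have 1: "mink (vd_zbar (vd_z p) z) (q z) + mink (vd_z p z) (vd_zbar q z) = d_zbar (d_z E) z / 2"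
    using d_zbar_relation[OF csm'(3,2) second_derivatives(4) z] d_zbar_cmult[of "d_z E" z "1/2"] by simp
  have 2: "mink (vd_zbar p z) (vd_zbar p z) = (of_real H)\<^sup>2 * (E z)\<^sup>2 / 4 - (E z)\<^sup>2 / 4"
    by (subst frame_expansion[OF z])
      (simp add: second_derivatives[OF z] H_eq[OF z] power2_eq_square)
  have 3: "mink (vd_zbar (vd_z p) z) (q z) = - mink (vd_zbar p z) (vd_zbar p z)"
    using d_z_relation[OF csm'(4,2) second_derivatives(2) z]
    by (simp add: d_z_const vd_z_vd_zbar_commute[OF csm(1) z] vd_z_vd_zbar_commute[OF csm'(1) z] add_eq_0_iff2)
  have 4: "mink (vd_z p z) (vd_zbar q z) = Q z * cnj (Q z) + d_z E z * d_zbar E z / (2 * E z)"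
    using E0 by (subst frame_expansion[OF z])
      (simp add: second_derivatives[OF z] Q_eq[OF z] divide_simps)
  have "d_zbar (d_z E) z / 2 = Q z * cnj (Q z) + d_z E z * d_zbar E z / (2 * E z)
      - ((of_real H)\<^sup>2 * (E z)\<^sup>2 / 4 - (E z)\<^sup>2 / 4)"
    unfolding 1[symmetric] 3 2 4 by simp
  then have "E z * d_zbar (d_z uc) z = Q z * cnj (Q z) + (E z)\<^sup>2 / 4 * (1 - (of_real H)\<^sup>2)"
    using E0 unfolding ddE d_E[OF z] by (simp add: field_simps power2_eq_square) algebra
  then show ?thesis using E0 by (simp add: field_simps power2_eq_square)
qed

end


section \<open>The unitary member of the deformation\<close>

context cmc_surface
begin

text \<open>
  With $s^2(1 + H) = H - 1$ one has $|r|^2 = \frac14e^{2u}(H^2 - 1)$ and $|q|^2 = e^{-2u}|Q|^2$, so the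
  third equation is Gauss's equation; the equation for $q$ is Codazzi's, and the equation for $r$
  holds since $r$ is a constant multiple of $e^u$.
\<close>

lemma harmonic_data_deformed:
  assumes "simply_connected D" "0 \<in> D" and s: "s\<^sup>2 * (1 + H) = H - 1" and \<theta>: "\<theta> * cnj \<theta> = 1"
  defines "\<upsilon> \<equiv> (\<lambda>z. (1/2) * d_z uc z)"
    and "q' \<equiv> (\<lambda>z. (- cnj \<theta>) * (complex_of_real (exp (- u z)) * Q z))"
    and "r' \<equiv> (\<lambda>z. (cnj \<theta> * (of_real s / 2) * (1 + of_real H)) * complex_of_real (exp (u z)))"
  shows "harmonic_data D \<upsilon> q' r'"
proof
  show "open D" "simply_connected D" "0 \<in> D" using D assms(1,2) by blast+
  have Ce: "Ck_on n D (\<lambda>z. complex_of_real (exp (u z)))" "Ck_on n D (\<lambda>z. complex_of_real (exp (- u z)))" for n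
    by (intro Ck_on_bounded_linear[OF bounded_linear_of_real D] Ck_on_exp[OF D] smooth_u
        Ck_on_bounded_linear[OF bounded_linear_minus[OF bounded_linear_ident] D])+
  note m = Ck_on_bounded_linear[OF bounded_linear_mult_right D]
  show "Ck_on n D \<upsilon>" "Ck_on n D q'" "Ck_on n D r'" for n
    unfolding \<upsilon>_def q'_def r'_def
    by (intro m Ck_on_d_z[OF D Ck_on_uc] Ck_on_bilinear[OF bounded_bilinear_mult D] Ce smooth_Q)+
  fix z assume z: "z \<in> D"
  have de: "d_zbar (\<lambda>z. complex_of_real (exp (u z))) z = of_real (exp (u z)) * d_zbar uc z"
    using d_zbar_chain_real[OF differentiable_u[OF z] DERIV_exp] by (simp add: uc_def[abs_def])
  have "((\<lambda>x. exp (- x)) has_field_derivative - exp (- u z)) (at (u z))"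
    by (auto intro!: derivative_eq_intros)
  note de' = d_zbar_chain_real[OF differentiable_u[OF z] this, folded uc_def]
  have diff: "(\<lambda>z. complex_of_real (exp (u z))) differentiable (at z)"
    "(\<lambda>z. complex_of_real (exp (- u z))) differentiable (at z)" "Q differentiable (at z)"
    "d_z uc differentiable (at z)" "uc differentiable (at z)"
    using Ce[of 1] smooth_Q[of 1] Ck_on_d_z[OF D Ck_on_uc, of 1] Ck_on_uc[of 1] z by simp_all
  have ub: "cnj (d_z uc z) = d_zbar uc z"
    using d_zbar_cnj[OF diff(5)] by (simp add: uc_def[abs_def])
  show "d_zbar q' z = - 2 * cnj (\<upsilon> z) * q' z"
    unfolding q'_def \<upsilon>_def
    by (simp only: d_zbar_cmult[OF differentiable_mult[OF diff(2,3)]] d_zbar_mult[OF diff(2,3)]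
        de' codazzi[OF z]) (simp add: ub)
  show "d_zbar r' z = 2 * cnj (\<upsilon> z) * r' z"
    unfolding r'_def \<upsilon>_def by (simp only: d_zbar_cmult[OF diff(1)] de) (simp add: ub)
  have E: "E z = of_real (exp (u z)) * of_real (exp (u z))"
    by (simp add: E_def exp_add[symmetric] flip: of_real_mult)
  have real: "cnj (d_zbar (d_z uc) z) = d_zbar (d_z uc) z"
    unfolding gauss[OF z] by (simp add: E_def mult.commute)
  have d\<upsilon>: "d_zbar \<upsilon> z = 1 / 2 * d_zbar (d_z uc) z"
    unfolding \<upsilon>_def by (rule d_zbar_cmult[OF diff(4)])
  have "d_zbar \<upsilon> z + cnj (d_zbar \<upsilon> z) = d_zbar (d_z uc) z"
    unfolding d\<upsilon> by (simp add: real)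
  then have \<upsilon>\<upsilon>: "d_zbar \<upsilon> z + cnj (d_zbar \<upsilon> z) = E z / 4 * (1 - (of_real H)\<^sup>2) + Q z * cnj (Q z) / E z"
    unfolding gauss[OF z] .
  have qq: "q' z * cnj (q' z) = Q z * cnj (Q z) / E z"
  proof -
    have "q' z * cnj (q' z) = (\<theta> * cnj \<theta>) * (of_real (exp (- u z)) * of_real (exp (- u z))) * (Q z * cnj (Q z))"
      by (simp add: q'_def mult_ac)
    then show ?thesis by (simp add: \<theta> E exp_minus divide_simps)
  qed
  have rr: "r' z * cnj (r' z) = E z / 4 * ((of_real H)\<^sup>2 - 1)"
  proof -
    have rr: "r' z * cnj (r' z) = (\<theta> * cnj \<theta>) * E z / 4 * of_real (s\<^sup>2 * (1 + H) * (1 + H))"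
      by (simp add: r'_def E mult_ac power2_eq_square)
    show ?thesis unfolding rr \<theta> s by (simp add: algebra_simps power2_eq_square)
  qed
  show "d_zbar \<upsilon> z + cnj (d_zbar \<upsilon> z) = q' z * cnj (q' z) - r' z * cnj (r' z)"
    unfolding \<upsilon>\<upsilon> qq rr by (simp add: field_simps)
qed

text \<open>
  For this value of $s$ the $d\bar z$-coefficient of the deformed form is minus the adjoint of its
  $dz$-coefficient.
\<close>

lemma Omega_eq_one_form:
  assumes s: "s\<^sup>2 * (1 + H) = H - 1" "s \<noteq> 0" and \<theta>: "\<theta> * cnj \<theta> = 1" and z: "z \<in> D"
  defines "\<upsilon> \<equiv> (\<lambda>z. (1/2) * d_z uc z)"
    and "q' \<equiv> (\<lambda>z. (- cnj \<theta>) * (complex_of_real (exp (- u z)) * Q z))"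
    and "r' \<equiv> (\<lambda>z. (cnj \<theta> * (of_real s / 2) * (1 + of_real H)) * complex_of_real (exp (u z)))"
  shows "Omega u Q H s \<theta> z v = one_form (Omega_x \<upsilon> q' r') (Omega_y \<upsilon> q' r') z v"
proof -
  have i: "inverse \<theta> = cnj \<theta>" using \<theta> by (metis inverse_unique)
  have "inverse s * (1 - H) = - s * (1 + H)"
    using s by (simp add: field_simps power2_eq_square)
  then have s': "inverse (complex_of_real s) * (1 - of_real H) = - of_real s * (1 + of_real H)"
    by (metis (no_types, lifting) of_real_1 of_real_add of_real_diff of_real_inverse of_real_minus of_real_mult)
  have "uc differentiable (at z)" using Ck_on_uc[of 1] z by simp
  from d_zbar_cnj[OF this] have ub: "d_zbar uc z = cnj (d_z uc z)" by (simp add: uc_def[abs_def])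
  obtain a b where v: "v = Complex a b" by (cases v)
  have 12: "\<theta> * (inverse (of_real s) / 2) * e * (1 - of_real H) = - (\<theta> * (of_real s / 2) * e * (1 + of_real H))"
    for e :: complex
  proof -
    have "\<theta> * (inverse (of_real s) / 2) * e * (1 - of_real H) = \<theta> / 2 * e * (inverse (of_real s) * (1 - of_real H))"
      by simp
    then show ?thesis unfolding s' by simp
  qed
  show ?thesis
    unfolding Omega_def Omega_dz_def Omega_dzbar_def Let_def uc_def[symmetric] ub i 12
      v complex_cnj complex.sel Complex_eq
    by (simp add: vec_eq_iff forall_2 one_form_def Omega_x_def Omega_y_def \<upsilon>_def q'_def r'_def
        scaleR_conv_of_real[where 'a = complex] exp_minus algebra_simps)
qed

end


lemma matrix_inv:
  assumes "invertible A"
  shows "matrix_inv A ** A = mat 1" "A ** matrix_inv A = mat 1"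
  using someI_ex[OF assms[unfolded invertible_def]] by (simp_all add: matrix_inv_def)

lemma sigma3_squared: "sigma3 ** sigma3 = mat 1"
  by (simp add: sigma3_def vec_eq_iff forall_2 matrix_matrix_mult_def sum_2 mat_def)

lemma matrix_inv_sigma3: "matrix_inv sigma3 = sigma3"
proof -
  have "invertible sigma3" using sigma3_squared by (auto simp: invertible_def)
  then have "matrix_inv sigma3 ** sigma3 ** sigma3 = sigma3" by (simp add: matrix_inv)
  then show ?thesis by (simp add: matrix_mul_assoc[symmetric] sigma3_squared)
qed

text \<open>
  The off-diagonal entries of the form are odd in $\theta$ and its diagonal entries are even. By
  uniqueness the frame inherits this symmetry.
\<close>

lemma Omega_twist:
  "Omega u Q H s (- \<theta>) z v = sigma3 ** Omega u Q H s \<theta> z v ** sigma3"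
  by (simp add: vec_eq_iff forall_2 Omega_def Omega_dz_def Omega_dzbar_def Let_def sigma3_def
      matrix_matrix_mult_def sum_2)

theorem theorem3:
  fixes D :: "complex set"
    and f N :: "complex \<Rightarrow> real^4"
    and u :: "complex \<Rightarrow> real"
    and Q :: "complex \<Rightarrow> complex"
    and H :: real
  assumes "open D" and "simply_connected D" and "0 \<in> D"
    and "conformal_immersion D f u"
    and "unit_normal D f N"
    and "\<forall>z\<in>D. Q z = hopf_coeff f N z"
    and "\<forall>z\<in>D. has_mean_curvature f N u H z"
    and "\<bar>H\<bar> > 1"
  shows "\<exists>s0>0. \<exists>F.
    deformed_frame D u Q H s0 F \<and>
    (\<forall>G. deformed_frame D u Q H s0 G \<longrightarrow> (\<forall>z\<in>D. \<forall>\<theta>\<in>sphere 0 1. G z \<theta> = F z \<theta>)) \<and>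
    (\<forall>z\<in>D. F z \<in> Loop_SU2) \<and>
    (\<forall>\<theta>\<in>sphere 0 1. harmonic_into_sphere D (\<lambda>z. proj_S2 (F z \<theta>)))"
proof -
  interpret cmc_surface D f N u Q H
    using assms by unfold_locales auto
  have conn: "connected D" using assms(2) simply_connected_imp_connected by blast
  define s where "s = sqrt ((H - 1) / (H + 1))"
  have H: "(H - 1) / (H + 1) > 0" "H + 1 \<noteq> 0" using assms(8) by (auto simp: zero_less_divide_iff)
  have s: "s > 0" using H(1) by (simp add: s_def)
  have "s\<^sup>2 = (H - 1) / (H + 1)" using H(1) by (simp add: s_def)
  then have sH: "s\<^sup>2 * (1 + H) = H - 1" using H(2) by (simp add: field_simps)
  have circle: "\<theta> * cnj \<theta> = 1" if "\<theta> \<in> sphere 0 1" for \<theta> :: complex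
    using that by (simp add: complex_norm_square[symmetric])
  let ?\<omega> = "Omega u Q H s"
  have skew: "adj (?\<omega> \<theta> z v) = - ?\<omega> \<theta> z v" if "\<theta> \<in> sphere 0 1" "z \<in> D" for \<theta> z v
    unfolding Omega_eq_one_form[OF sH less_imp_neq[OF s, symmetric] circle[OF that(1)] that(2)] by (rule one_form_skew)
  have "\<exists>F. F 0 = mat 1 \<and> (\<forall>z\<in>D. (F has_derivative (\<lambda>v. F z ** ?\<omega> \<theta> z v)) (at z) \<and> F z \<in> SU2) \<and>
      harmonic_into_sphere D (\<lambda>z. proj_S2 (F z))" if \<theta>: "\<theta> \<in> sphere 0 1" for \<theta>
  proof -
    note \<omega> = Omega_eq_one_form[OF sH less_imp_neq[OF s, symmetric] circle[OF \<theta>]]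
    show ?thesis
      by (rule harmonic_data.harmonic_frame[OF harmonic_data_deformed[OF assms(2,3) sH circle[OF \<theta>]]])
        (intro exI conjI ballI, assumption, simp add: \<omega>)
  qed
  then obtain F' where F0: "\<And>\<theta>. \<theta> \<in> sphere 0 1 \<Longrightarrow> F' \<theta> 0 = mat 1"
    and F': "\<And>\<theta> z. \<theta> \<in> sphere 0 1 \<Longrightarrow> z \<in> D \<Longrightarrow> (F' \<theta> has_derivative (\<lambda>v. F' \<theta> z ** ?\<omega> \<theta> z v)) (at z)"
    and SU: "\<And>\<theta> z. \<theta> \<in> sphere 0 1 \<Longrightarrow> z \<in> D \<Longrightarrow> F' \<theta> z \<in> SU2"
    and harm: "\<And>\<theta>. \<theta> \<in> sphere 0 1 \<Longrightarrow> harmonic_into_sphere D (\<lambda>z. proj_S2 (F' \<theta> z))"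
    by metis
  have inv: "matrix_inv A ** A = mat 1" "A ** matrix_inv A = mat 1" if "det A = 1" for A :: "complex^2^2"
    using that by (simp_all add: matrix_inv invertible_det_nz)
  define F where "F z \<theta> = F' \<theta> z" for z \<theta>
  have "deformed_frame D u Q H s F"
    unfolding deformed_frame_def F_def
  proof (intro ballI conjI allI)
    fix \<theta> :: complex assume \<theta>: "\<theta> \<in> sphere 0 1"
    show "F' \<theta> 0 = mat 1" by (rule F0[OF \<theta>])
    fix z assume z: "z \<in> D"
    show det: "det (F' \<theta> z) = 1" using SU[OF \<theta> z] by (simp add: SU2_def)
    show "(\<lambda>w. F' \<theta> w) differentiable (at z)" using F'[OF \<theta> z] by (auto simp: differentiable_def)
    show "matrix_inv (F' \<theta> z) ** frechet_derivative (\<lambda>w. F' \<theta> w) (at z) v = ?\<omega> \<theta> z v" for v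
      by (simp add: frechet_derivative_at[OF F'[OF \<theta> z], symmetric] matrix_mul_assoc inv[OF det])
  qed
  moreover have "G z \<theta> = F z \<theta>" if G: "deformed_frame D u Q H s G" and z: "z \<in> D" and \<theta>: "\<theta> \<in> sphere 0 1" for G z \<theta>
  proof -
    have G': "((\<lambda>w. G w \<theta>) has_derivative (\<lambda>v. G w \<theta> ** ?\<omega> \<theta> w v)) (at w)" if "w \<in> D" for w
    proof -
      have *: "det (G w \<theta>) = 1" "(\<lambda>w. G w \<theta>) differentiable (at w)"
        "\<And>v. matrix_inv (G w \<theta>) ** frechet_derivative (\<lambda>w. G w \<theta>) (at w) v = ?\<omega> \<theta> w v"
        using G \<theta> that by (auto simp: deformed_frame_def)
      have "G w \<theta> ** ?\<omega> \<theta> w v = frechet_derivative (\<lambda>w. G w \<theta>) (at w) v" for v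
        unfolding *(3)[symmetric] by (simp add: matrix_mul_assoc inv[OF *(1)])
      then show ?thesis using *(2) by (simp add: frechet_derivative_works[symmetric] eta_contract_eq)
    qed
    have G0: "G 0 \<theta> = mat 1" using G \<theta> by (auto simp: deformed_frame_def)
    show ?thesis
      unfolding F_def
      by (rule frames_agree(2)[OF assms(1) conn assms(3) G0 F0[OF \<theta>] G' F'[OF \<theta>] skew[OF \<theta>] z])
  qed
  moreover have "F z \<in> Loop_SU2" if z: "z \<in> D" for z
  proof -
    have "F' (- \<theta>) z = sigma3 ** F' \<theta> z ** sigma3" if \<theta>: "\<theta> \<in> sphere 0 1" for \<theta>
    proof -
      have m\<theta>: "- \<theta> \<in> sphere 0 1" using \<theta> by simp
      have G': "((\<lambda>w. sigma3 ** F' \<theta> w ** sigma3) has_derivative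
          (\<lambda>v. sigma3 ** F' \<theta> w ** sigma3 ** ?\<omega> (- \<theta>) w v)) (at w)" if w: "w \<in> D" for w
      proof -
        have "((\<lambda>w. sigma3 ** F' \<theta> w ** sigma3) has_derivative
            (\<lambda>v. sigma3 ** (F' \<theta> w ** ?\<omega> \<theta> w v) ** sigma3)) (at w)"
          by (intro bounded_linear.has_derivative[OF matmul.bounded_linear_left]
              bounded_linear.has_derivative[OF matmul.bounded_linear_right] F'[OF \<theta> w])
        moreover have "sigma3 ** (F' \<theta> w ** ?\<omega> \<theta> w v) ** sigma3 =
            sigma3 ** F' \<theta> w ** (sigma3 ** sigma3) ** ?\<omega> \<theta> w v ** sigma3" for v
          by (simp add: sigma3_squared matrix_mul_assoc)
        ultimately show ?thesis by (simp add: Omega_twist matrix_mul_assoc)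
      qed
      have G0: "sigma3 ** F' \<theta> 0 ** sigma3 = mat 1" by (simp add: F0[OF \<theta>] sigma3_squared)
      show ?thesis
        by (rule frames_agree(2)[OF assms(1) conn assms(3) F0[OF m\<theta>] G0 F'[OF m\<theta>] G' skew[OF m\<theta>] z])
    qed
    then show ?thesis
      using SU[OF _ z] by (auto simp: Loop_SU2_def Loop_SL2_def F_def matrix_inv_sigma3 SU2_def)
  qed
  moreover have "\<forall>\<theta>\<in>sphere 0 1. harmonic_into_sphere D (\<lambda>z. proj_S2 (F z \<theta>))"
    using harm by (simp add: F_def)
  ultimately show ?thesis using s by blast
qed

end
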